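(* Let $r,n\ge1$ be integers, and let $\widehat{H}_{r,n}^{\mathrm{aff}}$ and $\widehat{\mathcal{C}}_{r,n}^{\mathrm{aff}}$ be the $R$-algebras defined by generators and relations in the context. There is an $R$-algebra isomorphism $\phi:\widehat{H}_{r,n}^{\mathrm{aff}}\to\widehat{\mathcal{C}}_{r,n}^{\mathrm{aff}}$ given by $\phi(t_j)=w_j$ for $1\le j\le n$, $\phi(T_\rho^{\pm1})=h_\rho^{\pm1}$, and for $0\le i\le n-1$ $$\phi(T_{s_i})=h_{s_i}-\Delta^{-2}(q-q^{-1})\sum_{1\le c_1<c_2\le r}F_{c_1}(w_i)F_{c_2}(w_{i+1}).$$ Moreover, its inverse $\psi:\widehat{\mathcal{C}}_{r,n}^{\mathrm{aff}}\to\widehat{H}_{r,n}^{\mathrm{aff}}$ is given by $\psi(w_j)=t_j$ for $1\le j\le n$, $\psi(h_\rho^{\pm1})=T_\rho^{\pm1}$, and for $0\le i\le n-1$ $$\psi(h_{s_i})=T_{s_i}+\Delta^{-2}(q-q^{-1})\sum_{1\le c_1<c_2\le r}F_{c_1}(t_i)F_{c_2}(t_{i+1}).$$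
   Context: Let $\zeta=e^{2\pi i/r}$, let $A$ be the $r\times r$ matrix with entries $a_{ij}=\zeta^{j(i-1)}$ ($1\le i,j\le r$), $\Delta=\det A=\prod_{1\le j<i\le r}(\zeta^i-\zeta^j)$, and write $A^{-1}=\Delta^{-1}B$ with $B=(b_{ij}(\zeta))$ the adjugate matrix of $A$. For $1\le i\le r$ put $F_i(X)=\sum_{1\le j\le r}b_{ij}(\zeta)X^{j-1}\in\mathbb{Z}[\zeta][X]$. Let $q$ be an indeterminate and $R=\mathbb{Z}[\frac1r][q,q^{-1},\zeta,\Delta^{-1}]$. Algebras are associative and unital. Let $s_i=(i,i+1)$ for $1\le i\le n-1$; for an integer $i$, $\overline{i}\in\{0,\dots,n-1\}$ is its residue mod $n$. Conventions: $t_0:=t_n$, $w_0:=w_n$. The algebra $\widehat{H}_{r,n}^{\mathrm{aff}}$ is the $R$-algebra generated by $t_1,\dots,t_n,T_{s_0},\dots,T_{s_{n-1}},T_\rho^{\pm1}$ with relations: $t_i^r=1$; $t_it_j=t_jt_i$; $T_{s_i}t_j=t_{s_i(j)}T_{s_i}$ for $1\le i\le n-1$, $1\le j\le n$; $T_\rho t_j=t_{j-1}T_\rho$ for $1\le j\le n$; $T_\rho T_{s_{\overline i}}=T_{s_{\overline{i-1}}}T_\rho$ for $0\le i\le n-1$; $T_{s_i}T_{s_j}=T_{s_j}T_{s_i}$ if $i-j\not\equiv\pm1\pmod n$; $T_{s_{\overline i}}T_{s_{\overline{i+1}}}T_{s_{\overline i}}=T_{s_{\overline{i+1}}}T_{s_{\overline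 i}}T_{s_{\overline{i+1}}}$ if $0\le i\le n-1$ and $n\ge3$; $T_{s_i}^2=1+(q-q^{-1})e_iT_{s_i}$ for $0\le i\le n-1$, where $e_i=\frac1r\sum_{s=0}^{r-1}t_i^st_{i+1}^{-s}$; $T_\rho T_\rho^{-1}=T_\rho^{-1}T_\rho=1$. The algebra $\widehat{\mathcal{C}}_{r,n}^{\mathrm{aff}}$ is the $R$-algebra generated by $w_1,\dots,w_n,h_{s_0},\dots,h_{s_{n-1}},h_\rho^{\pm1}$ with relations: $w_i^r=1$; $w_iw_j=w_jw_i$; $h_\rho w_j=w_{j-1}h_\rho$ for $1\le j\le n$; $h_\rho h_{s_{\overline i}}=h_{s_{\overline{i-1}}}h_\rho$ for $0\le i\le n-1$; $h_{s_i}h_{s_j}=h_{s_j}h_{s_i}$ if $i-j\not\equiv\pm1\pmod n$; $h_{s_{\overline i}}h_{s_{\overline{i+1}}}h_{s_{\overline i}}=h_{s_{\overline{i+1}}}h_{s_{\overline i}}h_{s_{\overline{i+1}}}$ if $0\le i\le n-1$ and $n\ge3$; $h_{s_i}^2=1+(q-q^{-1})h_{s_i}$ for $0\le i\le n-1$; for $1\le i\le n-1$, $$h_{s_i}w_i=w_{i+1}h_{s_i}-\Delta^{-2}\sum_{1\le c_1<c_2\le r}(\zeta^{c_2}-\zeta^{c_1})(q-q^{-1})F_{c_1}(w_i)F_{c_2}(w_{i+1}),$$ $$h_{s_i}w_{i+1}=w_ih_{s_i}+\Delta^{-2}\sum_{1\le c_1<c_2\le r}(\zeta^{c_2}-\zeta^{c_1})(q-q^{-1})F_{c_1}(w_i)F_{c_2}(w_{i+1});$$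 $h_{s_i}w_l=w_lh_{s_i}$ for $1\le i\le n-1$ and $l\ne i,i+1$; $h_\rho h_\rho^{-1}=h_\rho^{-1}h_\rho=1$. *)

theory Defs
  imports
    "HOL-Algebra.Algebraic_Closure_Type"
    "HOL-Algebra.Generated_Rings"
    "HOL-Algebra.QuotRing"
    "HOL-Computational_Algebra.Formal_Laurent_Series"
    "HOL-Combinatorics.Transposition"
    "HOL-Library.Poly_Mapping"
    "HOL-Number_Theory.Cong"
    "Jordan_Normal_Form.Determinant"
begin

section \<open>Algebras given by generators and relations\<close>

text \<open>Words form the free monoid; it is written additively because
  \<^theory>\<open>HOL-Library.Poly_Mapping\<close> builds the monoid algebra
  \<open>'m \<Rightarrow>\<^sub>0 'k\<close> of an additively written monoid \<open>'m\<close>.  Hence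
  \<open>'g word \<Rightarrow>\<^sub>0 'k\<close> is the algebra of noncommutative polynomials over \<open>'k\<close>.\<close>

datatype 'g word = Word (letters: "'g list")

instantiation word :: (type) monoid_add
begin

definition "0 = Word []"
definition "u + v = Word (letters u @ letters v)"

instance
  by standard (simp_all add: zero_word_def plus_word_def)

end

definition scalar :: "'k::zero \<Rightarrow> ('g word \<Rightarrow>\<^sub>0 'k)"
  where "scalar c = Poly_Mapping.single 0 c"

definition generator :: "'g \<Rightarrow> ('g word \<Rightarrow>\<^sub>0 'k::zero_neq_one)"
  where "generator g = Poly_Mapping.single (Word [g]) 1"

text \<open>The free associative unital algebra on the set \<open>G\<close>
  over a subring \<open>K\<close> of the ambient ring of type \<open>'k\<close>.\<close>

definition free_algebra :: "'k::comm_ring_1 set \<Rightarrow> 'g set \<Rightarrow> ('k, 'g word \<Rightarrow>\<^sub>0 'k) module"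
  where "free_algebra K G =
    \<lparr>carrier = {p. \<forall>w \<in> Poly_Mapping.keys p. Poly_Mapping.lookup p w \<in> K \<and> set (letters w) \<subseteq> G},
     monoid.mult = (\<lambda>x y. x * y), one = 1, ring.zero = 0, add = (\<lambda>x y. x + y),
     module.smult = (\<lambda>c p. scalar c * p)\<rparr>"

definition quotient_algebra :: "('k, 'a) module \<Rightarrow> 'a set \<Rightarrow> ('k, 'a set) module"
  where "quotient_algebra A I =
    \<lparr>carrier = carrier (A Quot I), monoid.mult = monoid.mult (A Quot I),
     one = \<one>\<^bsub>A Quot I\<^esub>, ring.zero = \<zero>\<^bsub>A Quot I\<^esub>, add = add (A Quot I),
     module.smult = (\<lambda>c Y. \<Union>x\<in>Y. I +>\<^bsub>A\<^esub> (c \<odot>\<^bsub>A\<^esub> x))\<rparr>"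

text \<open>A relation \<open>x = y\<close> is represented by the pair \<open>(x, y)\<close>.\<close>

definition relation_ideal ::
    "'k::comm_ring_1 set \<Rightarrow> 'g set \<Rightarrow> (('g word \<Rightarrow>\<^sub>0 'k) \<times> ('g word \<Rightarrow>\<^sub>0 'k)) set \<Rightarrow> ('g word \<Rightarrow>\<^sub>0 'k) set"
  where "relation_ideal K G rel = Idl\<^bsub>free_algebra K G\<^esub> {x - y | x y. (x, y) \<in> rel}"

definition presented_algebra ::
    "'k::comm_ring_1 set \<Rightarrow> 'g set \<Rightarrow> (('g word \<Rightarrow>\<^sub>0 'k) \<times> ('g word \<Rightarrow>\<^sub>0 'k)) set
      \<Rightarrow> ('k, ('g word \<Rightarrow>\<^sub>0 'k) set) module"
  where "presented_algebra K G rel = quotient_algebra (free_algebra K G) (relation_ideal K G rel)"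

definition presented_class ::
    "'k::comm_ring_1 set \<Rightarrow> 'g set \<Rightarrow> (('g word \<Rightarrow>\<^sub>0 'k) \<times> ('g word \<Rightarrow>\<^sub>0 'k)) set
      \<Rightarrow> ('g word \<Rightarrow>\<^sub>0 'k) \<Rightarrow> ('g word \<Rightarrow>\<^sub>0 'k) set"
  where "presented_class K G rel x = relation_ideal K G rel +>\<^bsub>free_algebra K G\<^esub> x"

text \<open>The library's locale for algebras is restricted to commutative ones,
  so homomorphisms of associative algebras are introduced here.\<close>

definition algebra_hom :: "'k set \<Rightarrow> ('k, 'a) module \<Rightarrow> ('k, 'b) module \<Rightarrow> ('a \<Rightarrow> 'b) set"
  where "algebra_hom K A B =
    {f \<in> Ring.ring_hom A B. \<forall>c\<in>K. \<forall>x\<in>carrier A. f (c \<odot>\<^bsub>A\<^esub> x) = c \<odot>\<^bsub>B\<^esub> f x}"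

definition algebra_iso :: "'k set \<Rightarrow> ('k, 'a) module \<Rightarrow> ('k, 'b) module \<Rightarrow> ('a \<Rightarrow> 'b) set"
  where "algebra_iso K A B = {f \<in> algebra_hom K A B. bij_betw f (carrier A) (carrier B)}"


section \<open>The base ring\<close>

definition zeta :: "nat \<Rightarrow> complex"
  where "zeta r = exp (2 * of_real pi * \<i> / of_nat r)"

text \<open>Library matrices are indexed from 0, so the entry at \<open>(i, j)\<close>
  is \<open>a\<^bsub>i+1,j+1\<^esub>\<close>; conversely for \<open>b_coeff\<close>.\<close>

definition A_mat :: "nat \<Rightarrow> complex mat"
  where "A_mat r = mat r r (\<lambda>(i, j). zeta r ^ ((j + 1) * i))"

definition Delta :: "nat \<Rightarrow> complex"
  where "Delta r = det (A_mat r)"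

definition b_coeff :: "nat \<Rightarrow> nat \<Rightarrow> nat \<Rightarrow> complex"
  where "b_coeff r i j = adj_mat (A_mat r) $$ (i - 1, j - 1)"

text \<open>The Laurent polynomials over a subring of the complex numbers are
  realised inside the field of formal Laurent series in the variable \<open>q\<close>.\<close>

definition qvar :: "complex fls"
  where "qvar = fls_X"

definition base_ring :: "nat \<Rightarrow> complex fls set"
  where "base_ring r = generate_ring ring_of_type_algebra
    {fls_const (1 / of_nat r), qvar, inverse qvar, fls_const (zeta r), fls_const (inverse (Delta r))}"


section \<open>The two algebras\<close>

text \<open>Both presentations use the same alphabet: \<open>Tor j\<close> stands for \<open>t\<^sub>j\<close> or \<open>w\<^sub>j\<close>,
  \<open>Refl i\<close> for \<open>T\<close> or \<open>h\<close> at \<open>s\<^sub>i\<close>, and \<open>Rho\<close>, \<open>Rho_inv\<close> for \<open>T\<close> or \<open>h\<close> at \<open>\<rho>\<close>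
  and its inverse.\<close>

datatype gen = Tor nat | Refl nat | Rho | Rho_inv

type_synonym falg = "gen word \<Rightarrow>\<^sub>0 complex fls"

definition gens :: "nat \<Rightarrow> gen set"
  where "gens n = Tor ` {1..n} \<union> Refl ` {0..<n} \<union> {Rho, Rho_inv}"

definition tor :: "nat \<Rightarrow> nat \<Rightarrow> falg"
  where "tor n j = generator (Tor (if j = 0 then n else j))"

text \<open>The integer index is read modulo \<open>n\<close>.\<close>

definition sgen :: "nat \<Rightarrow> int \<Rightarrow> falg"
  where "sgen n i = generator (Refl (nat (i mod int n)))"

definition rho :: falg
  where "rho = generator Rho"

definition rho_inv :: falg
  where "rho_inv = generator Rho_inv"

text \<open>\<open>F_eval r i x\<close> is the value of the polynomial \<open>F\<^sub>i\<close> at \<open>x\<close>.\<close>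

definition F_eval :: "nat \<Rightarrow> nat \<Rightarrow> falg \<Rightarrow> falg"
  where "F_eval r i x = (\<Sum>j=1..r. scalar (fls_const (b_coeff r i j)) * x ^ (j - 1))"

text \<open>Negative powers: as \<open>t\<^sub>j ^ r = 1\<close> is imposed, the inverse of \<open>t\<^sub>j\<close> is \<open>t\<^sub>j ^ (r - 1)\<close>.\<close>

definition e_elt :: "nat \<Rightarrow> nat \<Rightarrow> nat \<Rightarrow> falg"
  where "e_elt r n i = scalar (fls_const (1 / of_nat r)) *
    (\<Sum>s<r. tor n i ^ s * (tor n (i + 1) ^ (r - 1)) ^ s)"

definition FF_sum :: "nat \<Rightarrow> nat \<Rightarrow> nat \<Rightarrow> falg"
  where "FF_sum r n i = scalar (fls_const (inverse (Delta r ^ 2)) * (qvar - inverse qvar)) *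
    (\<Sum>(c1, c2) \<in> {(c1, c2). 1 \<le> c1 \<and> c1 < c2 \<and> c2 \<le> r}.
       F_eval r c1 (tor n i) * F_eval r c2 (tor n (i + 1)))"

definition weighted_FF_sum :: "nat \<Rightarrow> nat \<Rightarrow> nat \<Rightarrow> falg"
  where "weighted_FF_sum r n i = scalar (fls_const (inverse (Delta r ^ 2))) *
    (\<Sum>(c1, c2) \<in> {(c1, c2). 1 \<le> c1 \<and> c1 < c2 \<and> c2 \<le> r}.
       scalar (fls_const (zeta r ^ c2 - zeta r ^ c1) * (qvar - inverse qvar)) *
       F_eval r c1 (tor n i) * F_eval r c2 (tor n (i + 1)))"

definition H_relations :: "nat \<Rightarrow> nat \<Rightarrow> (falg \<times> falg) set"
  where "H_relations r n =
    {(tor n i ^ r, 1) | i. i \<in> {1..n}} \<union>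
    {(tor n i * tor n j, tor n j * tor n i) | i j. i \<in> {1..n} \<and> j \<in> {1..n}} \<union>
    {(sgen n (int i) * tor n j, tor n (Transposition.transpose i (i + 1) j) * sgen n (int i))
       | i j. 1 \<le> i \<and> i < n \<and> j \<in> {1..n}} \<union>
    {(rho * tor n j, tor n (j - 1) * rho) | j. j \<in> {1..n}} \<union>
    {(rho * sgen n (int i), sgen n (int i - 1) * rho) | i. i < n} \<union>
    {(sgen n (int i) * sgen n (int j), sgen n (int j) * sgen n (int i))
       | i j. i < n \<and> j < n \<and>
         \<not> [int i - int j = 1] (mod int n) \<and> \<not> [int i - int j = - 1] (mod int n)} \<union>
    {(sgen n (int i) * sgen n (int i + 1) * sgen n (int i),
      sgen n (int i + 1) * sgen n (int i) * sgen n (int i + 1)) | i. i < n \<and> n \<ge> 3} \<union>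
    {(sgen n (int i) ^ 2, 1 + scalar (qvar - inverse qvar) * e_elt r n i * sgen n (int i)) | i. i < n} \<union>
    {(rho * rho_inv, 1), (rho_inv * rho, 1)}"

definition C_relations :: "nat \<Rightarrow> nat \<Rightarrow> (falg \<times> falg) set"
  where "C_relations r n =
    {(tor n i ^ r, 1) | i. i \<in> {1..n}} \<union>
    {(tor n i * tor n j, tor n j * tor n i) | i j. i \<in> {1..n} \<and> j \<in> {1..n}} \<union>
    {(rho * tor n j, tor n (j - 1) * rho) | j. j \<in> {1..n}} \<union>
    {(rho * sgen n (int i), sgen n (int i - 1) * rho) | i. i < n} \<union>
    {(sgen n (int i) * sgen n (int j), sgen n (int j) * sgen n (int i))
       | i j. i < n \<and> j < n \<and>
         \<not> [int i - int j = 1] (mod int n) \<and> \<not> [int i - int j = - 1] (mod int n)} \<union>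
    {(sgen n (int i) * sgen n (int i + 1) * sgen n (int i),
      sgen n (int i + 1) * sgen n (int i) * sgen n (int i + 1)) | i. i < n \<and> n \<ge> 3} \<union>
    {(sgen n (int i) ^ 2, 1 + scalar (qvar - inverse qvar) * sgen n (int i)) | i. i < n} \<union>
    {(sgen n (int i) * tor n i, tor n (i + 1) * sgen n (int i) - weighted_FF_sum r n i)
       | i. 1 \<le> i \<and> i < n} \<union>
    {(sgen n (int i) * tor n (i + 1), tor n i * sgen n (int i) + weighted_FF_sum r n i)
       | i. 1 \<le> i \<and> i < n} \<union>
    {(sgen n (int i) * tor n l, tor n l * sgen n (int i))
       | i l. 1 \<le> i \<and> i < n \<and> l \<in> {1..n} \<and> l \<noteq> i \<and> l \<noteq> i + 1} \<union>
    {(rho * rho_inv, 1), (rho_inv * rho, 1)}"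

definition H_aff :: "nat \<Rightarrow> nat \<Rightarrow> (complex fls, falg set) module"
  where "H_aff r n = presented_algebra (base_ring r) (gens n) (H_relations r n)"

definition C_aff :: "nat \<Rightarrow> nat \<Rightarrow> (complex fls, falg set) module"
  where "C_aff r n = presented_algebra (base_ring r) (gens n) (C_relations r n)"

definition H_class :: "nat \<Rightarrow> nat \<Rightarrow> falg \<Rightarrow> falg set"
  where "H_class r n x = presented_class (base_ring r) (gens n) (H_relations r n) x"

definition C_class :: "nat \<Rightarrow> nat \<Rightarrow> falg \<Rightarrow> falg set"
  where "C_class r n x = presented_class (base_ring r) (gens n) (C_relations r n) x"

end

theory Submission
  imports Defs
begin

text \<open>If \<open>x\<^sup>r = 1\<close>, then \<open>F\<^sub>c(x) / \<Delta>\<close> is the projection onto the eigenspace of \<open>x\<close> with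
  eigenvalue \<open>\<zeta>\<^sup>c\<close>.  For commuting \<open>x\<close> and \<open>y\<close> of this kind let \<open>p\<close>, \<open>p'\<close> and \<open>e\<close> be the
  projections onto the pairs of eigenvalues with \<open>c1 < c2\<close>, \<open>c1 > c2\<close> and \<open>c1 = c2\<close>, so that
  \<open>e\<close> is the element in the quadratic relation and the correction term is \<open>N = (q - q\<^sup>-\<^sup>1) p\<close>.
  If \<open>T\<close> interchanges \<open>x\<close> and \<open>y\<close>, then \<open>T p = p' T\<close>, and \<open>p + p' + e = 1\<close> gives
  \<open>(T + N)\<^sup>2 - (q - q\<^sup>-\<^sup>1) (T + N) = T\<^sup>2 - (q - q\<^sup>-\<^sup>1) e T\<close>.  In the same way the two sides
  of each other relation differ by the same amount for \<open>T\<close> and for \<open>T + N\<close>; for the braid relation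
  this rests on an identity between products of such projections for three commuting elements,
  which is checked on eigenvalues.  So the substitution \<open>T \<mapsto> T + N\<close> exchanges the two
  presentations.  The interchange relations for \<open>s\<^sub>0\<close>, which are not among the
  defining ones, follow by conjugating those for \<open>s\<^sub>1\<close> with \<open>\<rho>\<close>.\<close>

section \<open>Noncommutative polynomials and substitution\<close>

text \<open>The weight \<open>zeta^c2 - zeta^c1\<close> in the second presentation has a spectral
  origin. On the eigenvalues belonging to \<open>c1 < c2\<close>, left multiplication by
  \<open>y\<close> and by \<open>x\<close> differ by exactly this factor, so the weighted sum is
  \<open>(y - x) N\<close>. It therefore measures how far \<open>N\<close> is from interchanging
  \<open>x\<close> and \<open>y\<close>, and \<open>T + N\<close> inherits that defect. The base is
  a ring and not a field, so eigenspaces are replaced by elements: products of the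
  \<open>F_c / Delta\<close> serve as eigenvectors and sum to 1 exactly. Invertibility of
  \<open>Delta\<close> is what makes this possible. Each comparison of differences is read in both
  directions: with \<open>T = T_s\<close> in the first algebra, and with \<open>T = h_s - N\<close>
  in the second. In the second algebra the order of derivation matters. That \<open>h_s - N\<close>
  interchanges the torus elements comes before everything else, and its quadratic relation comes
  before the braid relation, because expanding the shifted braid relation produces squares. For
  \<open>n = 1\<close> the two torus elements coincide and no interchange is available; there
  \<open>N\<close> vanishes and \<open>e\<close> is 1.\<close>

lemma scalar_0 [simp]: "scalar 0 = 0"
  by (simp add: scalar_def)

lemma scalar_1 [simp]: "scalar 1 = 1"
  by (simp add: scalar_def)

lemma scalar_add: "scalar (a + b) = scalar a + scalar b"
  by (simp add: scalar_def single_add)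

lemma scalar_diff: "scalar (a - b :: 'k::comm_ring_1) = scalar a - scalar b"
  by (simp add: scalar_def single_diff)

lemma scalar_mult: "scalar (a * b :: 'k::comm_ring_1) = scalar a * scalar b"
  by (simp add: scalar_def mult_single)

lemma scalar_sum: "scalar (sum f A :: 'k::comm_ring_1) = (\<Sum>a\<in>A. scalar (f a))"
  by (induction A rule: infinite_finite_induct) (simp_all add: scalar_add)

lemma single_eq_scalar:
  "Poly_Mapping.single w (c :: 'k::comm_ring_1) = scalar c * Poly_Mapping.single w 1"
  by (simp add: scalar_def mult_single)

lemma sum_monomials_superset:
  assumes "finite A" "Poly_Mapping.keys p \<subseteq> A"
  shows "(\<Sum>w\<in>A. Poly_Mapping.single w (Poly_Mapping.lookup p w)) = p"
proof (rule poly_mapping_eqI)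
  fix k
  have "Poly_Mapping.lookup (\<Sum>w\<in>A. Poly_Mapping.single w (Poly_Mapping.lookup p w)) k
      = (\<Sum>w\<in>A. Poly_Mapping.lookup p w when w = k)"
    by (simp add: lookup_sum lookup_single)
  also have "\<dots> = Poly_Mapping.lookup p k"
    using assms by (auto simp: when_def in_keys_iff)
  finally show "Poly_Mapping.lookup (\<Sum>w\<in>A. Poly_Mapping.single w (Poly_Mapping.lookup p w)) k
      = Poly_Mapping.lookup p k" .
qed

lemma monomial_induct [case_names add single]:
  fixes p :: "'a \<Rightarrow>\<^sub>0 'b::comm_monoid_add"
  assumes "\<And>p q. P p \<Longrightarrow> P q \<Longrightarrow> P (p + q)" "\<And>w c. P (Poly_Mapping.single w c)"
  shows "P p"
proof -
  have "P (\<Sum>w\<in>A. Poly_Mapping.single w (Poly_Mapping.lookup p w))" if "finite A" for A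
    using that
  proof (induction A)
    case empty
    then show ?case using assms(2)[of undefined 0] by simp
  next
    case (insert w A)
    then show ?case using assms by simp
  qed
  from this[OF finite_keys[of p]] show ?thesis
    by (simp add: sum_monomials_superset)
qed

lemma scalar_commute:
  fixes p :: "'g word \<Rightarrow>\<^sub>0 'k::comm_ring_1"
  shows "p * scalar c = scalar c * p"
  by (induction p rule: monomial_induct) (simp_all add: algebra_simps scalar_def mult_single)

lemma scalar_left_commute:
  fixes p :: "'g word \<Rightarrow>\<^sub>0 'k::comm_ring_1"
  shows "p * (scalar c * q) = scalar c * (p * q)"
  by (metis scalar_commute mult.assoc)

text \<open>The algebra homomorphism out of the free algebra that extends \<open>f\<close>. It is
  total on the ambient type; that it preserves coefficients in a subring is shown separately in
  \<open>S_subst\<close>.\<close>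

definition subst :: "('g \<Rightarrow> ('h word \<Rightarrow>\<^sub>0 'k)) \<Rightarrow> ('g word \<Rightarrow>\<^sub>0 'k::comm_ring_1) \<Rightarrow> ('h word \<Rightarrow>\<^sub>0 'k)"
  where "subst f p =
    (\<Sum>w\<in>Poly_Mapping.keys p. scalar (Poly_Mapping.lookup p w) * prod_list (map f (letters w)))"

text \<open>Cancellation can make the support of \<open>p + q\<close> smaller than the union of the
  supports. Summing over a common finite superset makes additivity a termwise statement.\<close>

lemma subst_superset:
  assumes "finite A" "Poly_Mapping.keys p \<subseteq> A"
  shows "subst f p = (\<Sum>w\<in>A. scalar (Poly_Mapping.lookup p w) * prod_list (map f (letters w)))"
  unfolding subst_def using assms
  by (intro sum.mono_neutral_left) (auto simp: in_keys_iff)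

lemma subst_single: "subst f (Poly_Mapping.single w c) = scalar c * prod_list (map f (letters w))"
  by (subst subst_superset[of "{w}"]) auto

lemma subst_add: "subst f (p + q) = subst f p + subst f q"
proof -
  let ?A = "Poly_Mapping.keys p \<union> Poly_Mapping.keys q"
  show ?thesis
    using keys_add[of p q]
    by (simp add: subst_superset[of ?A] lookup_add scalar_add algebra_simps sum.distrib)
qed

lemma subst_0 [simp]: "subst f 0 = 0"
  by (simp add: subst_def)

lemma subst_scalar [simp]: "subst f (scalar c) = scalar c"
  using subst_single[of f 0 c] by (simp add: scalar_def zero_word_def)

lemma subst_1 [simp]: "subst f 1 = 1"
  using subst_scalar[of f 1] by simp

lemma subst_generator [simp]: "subst f (generator g) = f g"
  by (simp add: generator_def subst_single)

lemma subst_mult: "subst f (p * q) = subst f p * subst f q"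
proof (induction p rule: monomial_induct)
  case (single u a)
  show ?case
  proof (induction q rule: monomial_induct)
    case (single v b)
    show ?case
      using scalar_left_commute[of "prod_list (map f (letters u))" b "prod_list (map f (letters v))"]
      by (simp add: mult_single subst_single scalar_mult plus_word_def mult.assoc)
  qed (simp add: algebra_simps subst_add)
qed (simp add: algebra_simps subst_add)

lemma subst_uminus: "subst f (- p) = - subst f p"
  using subst_add[of f p "- p"] by (simp add: eq_neg_iff_add_eq_0 add.commute)

lemma subst_diff: "subst f (p - q) = subst f p - subst f q"
  using subst_add[of f p "- q"] by (simp add: subst_uminus)

lemma subst_sum: "subst f (sum g A) = (\<Sum>a\<in>A. subst f (g a))"
  by (induction A rule: infinite_finite_induct) (simp_all add: subst_add)

lemma subst_power: "subst f (p ^ m) = subst f p ^ m"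
  by (induction m) (simp_all add: subst_mult)

lemmas subst_simps = subst_add subst_mult subst_uminus subst_diff subst_sum subst_power


section \<open>Congruence modulo the relations\<close>

text \<open>The subring is a plain set inside the ambient type, so calculations use ordinary ring
  arithmetic and membership in \<open>K\<close> is only a side condition.\<close>

locale coefficient_ring =
  fixes K :: "'k::comm_ring_1 set" and G :: "'g set"
  assumes K_one [simp, intro]: "1 \<in> K"
    and K_diff [intro]: "\<And>a b. a \<in> K \<Longrightarrow> b \<in> K \<Longrightarrow> a - b \<in> K"
    and K_mult [intro]: "\<And>a b. a \<in> K \<Longrightarrow> b \<in> K \<Longrightarrow> a * b \<in> K"
begin

abbreviation "A \<equiv> free_algebra K G"
abbreviation "S \<equiv> carrier A"

lemma K_zero [simp, intro]: "0 \<in> K"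
  using K_diff[of 1 1] by simp

lemma K_uminus [intro]: "a \<in> K \<Longrightarrow> - a \<in> K"
  using K_diff[of 0 a] by simp

lemma K_add [intro]: "a \<in> K \<Longrightarrow> b \<in> K \<Longrightarrow> a + b \<in> K"
  using K_diff[of a "- b"] by auto

lemma K_sum [intro]: "(\<And>i. i \<in> J \<Longrightarrow> f i \<in> K) \<Longrightarrow> sum f J \<in> K"
  by (induction J rule: infinite_finite_induct) auto

lemma K_prod [intro]: "(\<And>i. i \<in> J \<Longrightarrow> f i \<in> K) \<Longrightarrow> prod f J \<in> K"
  by (induction J rule: infinite_finite_induct) auto

lemma K_power [intro]: "a \<in> K \<Longrightarrow> a ^ m \<in> K"
  by (induction m) auto

lemma mem_S: "p \<in> S \<longleftrightarrow>
    (\<forall>w. Poly_Mapping.lookup p w \<in> K \<and> (Poly_Mapping.lookup p w \<noteq> 0 \<longrightarrow> set (letters w) \<subseteq> G))"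
  by (auto simp: free_algebra_def in_keys_iff)

lemma S_diff [simp, intro]: "p \<in> S \<Longrightarrow> q \<in> S \<Longrightarrow> p - q \<in> S"
  unfolding mem_S lookup_minus by (metis K_diff diff_zero)

lemma S_scalar [simp, intro]: "c \<in> K \<Longrightarrow> scalar c \<in> S"
  by (auto simp: mem_S scalar_def lookup_single when_def zero_word_def)

lemma S_one [simp, intro]: "1 \<in> S"
  using S_scalar[OF K_one] by simp

lemma S_zero [simp, intro]: "0 \<in> S"
  using S_diff[of 1 1] by simp

lemma S_uminus [simp, intro]: "p \<in> S \<Longrightarrow> - p \<in> S"
  using S_diff[of 0 p] by simp

lemma S_add [simp, intro]: "p \<in> S \<Longrightarrow> q \<in> S \<Longrightarrow> p + q \<in> S"
  using S_diff[of p "- q"] by simp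

lemma S_sum [intro]: "(\<And>i. i \<in> J \<Longrightarrow> f i \<in> S) \<Longrightarrow> sum f J \<in> S"
  by (induction J rule: infinite_finite_induct) auto

lemma S_single:
  "c \<in> K \<Longrightarrow> c \<noteq> 0 \<Longrightarrow> Poly_Mapping.single w c \<in> S \<longleftrightarrow> set (letters w) \<subseteq> G"
  by (auto simp: mem_S lookup_single when_def)

lemma S_generator [simp, intro]: "g \<in> G \<Longrightarrow> generator g \<in> S"
  by (auto simp: generator_def S_single)

lemma S_mult [simp, intro]:
  assumes "p \<in> S" "q \<in> S"
  shows "p * q \<in> S"
proof -
  let ?m = "\<lambda>p w. Poly_Mapping.single w (Poly_Mapping.lookup p w)"
  have mono: "?m p u * ?m q v \<in> S"
    if "u \<in> Poly_Mapping.keys p" "v \<in> Poly_Mapping.keys q" for u v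
    using that assms
    by (auto simp: mem_S mult_single in_keys_iff lookup_single when_def plus_word_def)
  have "p * q = (\<Sum>u\<in>Poly_Mapping.keys p. ?m p u) * (\<Sum>v\<in>Poly_Mapping.keys q. ?m q v)"
    by (simp add: sum_monomials_superset)
  also have "\<dots> = (\<Sum>u\<in>Poly_Mapping.keys p. \<Sum>v\<in>Poly_Mapping.keys q. ?m p u * ?m q v)"
    by (simp add: sum_product)
  also have "\<dots> \<in> S"
    using mono by auto
  finally show ?thesis .
qed

lemma S_power [simp, intro]: "p \<in> S \<Longrightarrow> p ^ m \<in> S"
  by (induction m) auto

lemma S_prod_list: "set xs \<subseteq> S \<Longrightarrow> prod_list xs \<in> S"
  by (induction xs) auto

lemma S_subst:
  fixes f :: "'h \<Rightarrow> _"
  assumes "p \<in> carrier (free_algebra K G')" "\<And>g. g \<in> G' \<Longrightarrow> f g \<in> S"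
  shows "subst f p \<in> S"
proof -
  interpret G': coefficient_ring K G' by unfold_locales auto
  show ?thesis
    using assms unfolding subst_def G'.mem_S
    by (intro S_sum S_mult S_scalar S_prod_list) (force simp: in_keys_iff)+
qed

text \<open>Every element of \<open>S\<close> is a finite sum of coefficients times words, and every
  word is a product of generators from \<open>G\<close>.\<close>

lemma S_induct [consumes 1, case_names scalar generator add mult]:
  assumes "p \<in> S"
    and "\<And>c. c \<in> K \<Longrightarrow> P (scalar c)" "\<And>g. g \<in> G \<Longrightarrow> P (generator g)"
    and add: "\<And>p q. p \<in> S \<Longrightarrow> q \<in> S \<Longrightarrow> P p \<Longrightarrow> P q \<Longrightarrow> P (p + q)"
    and mult: "\<And>p q. p \<in> S \<Longrightarrow> q \<in> S \<Longrightarrow> P p \<Longrightarrow> P q \<Longrightarrow> P (p * q)"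
  shows "P p"
proof -
  have word: "Poly_Mapping.single (Word u) 1 \<in> S \<and> P (Poly_Mapping.single (Word u) 1)"
    if "set u \<subseteq> G" for u
    using that
  proof (induction u)
    case Nil
    show ?case using assms(2)[of 1] S_one by (simp flip: zero_word_def)
  next
    case (Cons g u)
    have "Poly_Mapping.single (Word (g # u)) (1::'k) = generator g * Poly_Mapping.single (Word u) 1"
      by (simp add: generator_def mult_single plus_word_def)
    moreover have "g \<in> G" "Poly_Mapping.single (Word u) 1 \<in> S" "P (Poly_Mapping.single (Word u) 1)"
      using Cons by simp_all
    ultimately show ?case
      using mult[OF S_generator _ assms(3)] by simp
  qed
  have sum: "(\<Sum>w\<in>B. Poly_Mapping.single w (Poly_Mapping.lookup p w)) \<in> S
      \<and> P (\<Sum>w\<in>B. Poly_Mapping.single w (Poly_Mapping.lookup p w))"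
    if "finite B" "B \<subseteq> Poly_Mapping.keys p" for B
    using that
  proof (induction B)
    case empty
    show ?case using assms(2)[of 0] by simp
  next
    case (insert w B)
    then have "set (letters w) \<subseteq> G" "Poly_Mapping.lookup p w \<in> K"
      using \<open>p \<in> S\<close> by (auto simp: mem_S in_keys_iff)
    then have "scalar (Poly_Mapping.lookup p w) * Poly_Mapping.single w 1 \<in> S \<and>
        P (scalar (Poly_Mapping.lookup p w) * Poly_Mapping.single w 1)"
      using word[of "letters w"] assms(2) mult S_mult S_scalar by simp
    with insert show ?case
      by (simp add: add flip: single_eq_scalar)
  qed
  from sum[OF finite_keys subset_refl] show ?thesis
    by (simp add: sum_monomials_superset)
qed

section \<open>The free algebra as a ring\<close>

lemma A_simps [simp]:
  "p \<otimes>\<^bsub>A\<^esub> q = p * q" "\<one>\<^bsub>A\<^esub> = 1" "\<zero>\<^bsub>A\<^esub> = 0" "p \<oplus>\<^bsub>A\<^esub> q = p + q"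
  "c \<odot>\<^bsub>A\<^esub> p = scalar c * p"
  by (simp_all add: free_algebra_def)

lemma abelian_group_A: "abelian_group A"
proof (rule abelian_groupI)
  fix p assume "p \<in> S"
  then show "\<exists>q\<in>S. q \<oplus>\<^bsub>A\<^esub> p = \<zero>\<^bsub>A\<^esub>"
    by (intro bexI[of _ "- p"]) (simp_all add: A_simps)
qed (simp_all add: A_simps ac_simps)

lemma monoid_A: "Group.monoid A"
  by (rule monoidI) (simp_all only: A_simps S_mult S_one mult.assoc mult_1_left mult_1_right)

sublocale A: ring A
  by (intro ringI abelian_group_A monoid_A) (simp_all only: A_simps distrib_left distrib_right)

lemma A_uminus [simp]: "p \<in> S \<Longrightarrow> \<ominus>\<^bsub>A\<^esub> p = - p"
  using A.minus_equality[of "- p" p] by simp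

lemma A_minus [simp]: "p \<in> S \<Longrightarrow> q \<in> S \<Longrightarrow> p \<ominus>\<^bsub>A\<^esub> q = p - q"
  by (simp only: a_minus_def A_uminus A_simps add_uminus_conv_diff)

end

section \<open>The quotient by the ideal of relations\<close>

locale presentation = coefficient_ring K G
  for K :: "'k::comm_ring_1 set" and G :: "'g set" +
  fixes rel :: "(('g word \<Rightarrow>\<^sub>0 'k) \<times> ('g word \<Rightarrow>\<^sub>0 'k)) set"
  assumes rel_S: "rel \<subseteq> S \<times> S"
begin

abbreviation "I \<equiv> relation_ideal K G rel"
abbreviation "Q \<equiv> presented_algebra K G rel"
abbreviation "cls \<equiv> presented_class K G rel"

text \<open>Both sides are required to lie in \<open>S\<close> because \<open>I\<close> is an ideal
  of \<open>A\<close> only: multiplying its elements by something outside \<open>S\<close> need not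
  stay in \<open>I\<close>.\<close>

definition eqv :: "('g word \<Rightarrow>\<^sub>0 'k) \<Rightarrow> ('g word \<Rightarrow>\<^sub>0 'k) \<Rightarrow> bool" (infix \<open>\<approx>\<close> 50)
  where "p \<approx> q \<longleftrightarrow> p \<in> S \<and> q \<in> S \<and> p - q \<in> I"

lemma rel_diff_S: "{x - y | x y. (x, y) \<in> rel} \<subseteq> S"
  using rel_S by auto

sublocale I: ideal I A
  unfolding relation_ideal_def by (rule A.genideal_ideal[OF rel_diff_S])

lemma I_diff: "p \<in> I \<Longrightarrow> q \<in> I \<Longrightarrow> p - q \<in> I"
  using I.a_closed[of p "\<ominus>\<^bsub>A\<^esub> q"] I.a_inv_closed[of q] I.Icarr[of q] by simp

lemma eqv_S: "p \<approx> q \<Longrightarrow> p \<in> S" "p \<approx> q \<Longrightarrow> q \<in> S"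
  by (simp_all add: eqv_def)

lemma eqv_refl [simp, intro]: "p \<in> S \<Longrightarrow> p \<approx> p"
  using I.zero_closed by (simp add: eqv_def)

lemma eqv_sym: "p \<approx> q \<Longrightarrow> q \<approx> p"
  using I_diff[of 0 "p - q"] eqv_refl[of 0] by (simp add: eqv_def)

lemma eqv_add: "p \<approx> q \<Longrightarrow> p' \<approx> q' \<Longrightarrow> p + p' \<approx> q + q'"
  using I.a_closed[of "p - q" "p' - q'"] by (simp add: eqv_def algebra_simps)

lemma eqv_diff: "p \<approx> q \<Longrightarrow> p' \<approx> q' \<Longrightarrow> p - p' \<approx> q - q'"
  using I_diff[of "p - q" "p' - q'"] by (simp add: eqv_def algebra_simps)

lemma eqv_trans [trans]:
  assumes "p \<approx> q" "q \<approx> s"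
  shows "p \<approx> s"
  using I.a_closed[of "p - q" "q - s"] assms by (simp add: eqv_def)

lemma eqv_mult:
  assumes "p \<approx> q" "p' \<approx> q'"
  shows "p * p' \<approx> q * q'"
proof -
  have "(p - q) * p' \<in> I" "q * (p' - q') \<in> I"
    using I.I_r_closed[of "p - q" p'] I.I_l_closed[of "p' - q'" q] assms by (simp_all add: eqv_def)
  then have "(p - q) * p' + q * (p' - q') \<in> I"
    using I.a_closed by fastforce
  then show ?thesis
    using assms by (simp add: eqv_def algebra_simps)
qed

lemma eqv_sum: "(\<And>i. i \<in> J \<Longrightarrow> f i \<approx> g i) \<Longrightarrow> sum f J \<approx> sum g J"
  by (induction J rule: infinite_finite_induct) (simp_all add: eqv_add)

lemma eqv_power: "p \<approx> q \<Longrightarrow> p ^ m \<approx> q ^ m"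
  by (induction m) (simp_all add: eqv_mult)

lemma eqv_rel: "(p, q) \<in> rel \<Longrightarrow> p \<approx> q"
  using A.genideal_self[OF rel_diff_S] rel_S unfolding eqv_def relation_ideal_def by blast

lemma cls_eq_iff: "p \<in> S \<Longrightarrow> q \<in> S \<Longrightarrow> cls p = cls q \<longleftrightarrow> p \<approx> q"
  using A.quotient_eq_iff_same_a_r_cos[OF I.is_ideal, of p q]
  by (simp add: presented_class_def eqv_def)

lemma carrier_Q: "carrier Q = cls ` S"
  by (auto simp: presented_algebra_def quotient_algebra_def FactRing_def A_RCOSETS_defs
      presented_class_def a_r_coset_def)

lemma one_Q: "\<one>\<^bsub>Q\<^esub> = cls 1"
  by (simp add: presented_algebra_def quotient_algebra_def FactRing_def presented_class_def)

lemma mult_Q: "p \<in> S \<Longrightarrow> q \<in> S \<Longrightarrow> cls p \<otimes>\<^bsub>Q\<^esub> cls q = cls (p * q)"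
  using I.rcoset_mult_add[of p q]
  by (simp add: presented_algebra_def quotient_algebra_def FactRing_def presented_class_def)

lemma add_Q: "p \<in> S \<Longrightarrow> q \<in> S \<Longrightarrow> cls p \<oplus>\<^bsub>Q\<^esub> cls q = cls (p + q)"
  using I.a_rcos_sum[of p q]
  by (simp add: presented_algebra_def quotient_algebra_def FactRing_def presented_class_def)

lemma mem_cls: "p \<in> S \<Longrightarrow> q \<in> cls p \<longleftrightarrow> q \<approx> p"
proof -
  assume p: "p \<in> S"
  have "q \<in> cls p \<longleftrightarrow> (\<exists>i\<in>I. q = i + p)"
    by (simp add: presented_class_def a_r_coset_def r_coset_def)
  also have "\<dots> \<longleftrightarrow> q - p \<in> I"
    by force
  also have "\<dots> \<longleftrightarrow> q \<approx> p"
    using p I.Icarr[of "q - p"] S_add[of "q - p" p] by (auto simp: eqv_def)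
  finally show ?thesis .
qed

text \<open>Scalar multiplication on the quotient and the induced maps are unions over all
  representatives. Independence of the representative collapses such a union to a single
  value.\<close>

lemma Union_cls:
  assumes "p \<in> S" "\<And>q. q \<approx> p \<Longrightarrow> F q = F p"
  shows "(\<Union>q\<in>cls p. F q) = F p"
  using assms mem_cls[of p] eqv_refl[of p] by blast

lemma smult_Q:
  assumes "p \<in> S" "c \<in> K"
  shows "c \<odot>\<^bsub>Q\<^esub> cls p = cls (scalar c * p)"
proof -
  have "c \<odot>\<^bsub>Q\<^esub> cls p = (\<Union>q\<in>cls p. cls (scalar c * q))"
    by (simp add: presented_algebra_def quotient_algebra_def presented_class_def)
  also have "\<dots> = cls (scalar c * p)"
    using assms by (intro Union_cls) (auto simp: cls_eq_iff eqv_S intro!: eqv_mult)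
  finally show ?thesis .
qed

end

text \<open>The elements that the substitution sends into \<open>I\<close> form an ideal of the
  source. It contains the relators of \<open>rel'\<close>, hence the ideal that they
  generate.\<close>

lemma (in presentation) subst_eqv:
  fixes G' :: "'h set"
  assumes "presentation K G' rel'"
    and f: "\<And>g. g \<in> G' \<Longrightarrow> f g \<in> S"
    and rel': "\<And>x y. (x, y) \<in> rel' \<Longrightarrow> subst f x \<approx> subst f y"
    and xy: "presentation.eqv K G' rel' x y"
  shows "subst f x \<approx> subst f y"
proof -
  interpret D: presentation K G' rel' by fact
  let ?J = "{p \<in> D.S. subst f p \<in> I}"
  have mem: "subst f p \<in> S" if "p \<in> D.S" for p
    using that f by (rule S_subst)
  have "ideal ?J D.A"
  proof (rule idealI[OF D.A.ring_axioms])
    show "subgroup ?J (add_monoid D.A)"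
    proof (rule D.A.add.subgroupI)
      fix p assume "p \<in> ?J"
      then show "\<ominus>\<^bsub>D.A\<^esub> p \<in> ?J"
        using I_diff[of 0 "subst f p"] eqv_refl[of 0] by (simp add: subst_uminus eqv_def)
    next
      fix p q assume "p \<in> ?J" "q \<in> ?J"
      then show "p \<oplus>\<^bsub>D.A\<^esub> q \<in> ?J"
        using I.a_closed[of "subst f p" "subst f q"] by (simp add: subst_add)
    next
      show "?J \<noteq> {}"
        using eqv_refl[of 0] by (auto simp: eqv_def intro!: exI[of _ 0])
    qed auto
  next
    fix p q assume "p \<in> ?J" "q \<in> D.S"
    then show "q \<otimes>\<^bsub>D.A\<^esub> p \<in> ?J" "p \<otimes>\<^bsub>D.A\<^esub> q \<in> ?J"
      using I.I_l_closed[of "subst f p" "subst f q"] I.I_r_closed[of "subst f p" "subst f q"] mem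
      by (simp_all add: subst_mult)
  qed
  moreover have "{x - y | x y. (x, y) \<in> rel'} \<subseteq> ?J"
    using rel' D.rel_S by (force simp: subst_diff eqv_def)
  ultimately have "D.I \<subseteq> ?J"
    unfolding relation_ideal_def by (rule D.A.genideal_minimal)
  then show ?thesis
    using xy mem by (auto simp: eqv_def D.eqv_def subst_diff)
qed

text \<open>Taking the union over all representatives avoids choosing one. When their images are
  congruent, all the united sets are the same class.\<close>

definition induced_map ::
    "'k::comm_ring_1 set \<Rightarrow> 'h set \<Rightarrow> (('h word \<Rightarrow>\<^sub>0 'k) \<times> ('h word \<Rightarrow>\<^sub>0 'k)) set
      \<Rightarrow> ('g \<Rightarrow> ('h word \<Rightarrow>\<^sub>0 'k)) \<Rightarrow> ('g word \<Rightarrow>\<^sub>0 'k) set \<Rightarrow> ('h word \<Rightarrow>\<^sub>0 'k) set"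
  where "induced_map K G rel f Y = (\<Union>p\<in>Y. presented_class K G rel (subst f p))"

lemma (in presentation)
  fixes G' :: "'h set"
  assumes D: "presentation K G' rel'"
    and f: "\<And>g. g \<in> G' \<Longrightarrow> f g \<in> S"
    and rel': "\<And>x y. (x, y) \<in> rel' \<Longrightarrow> subst f x \<approx> subst f y"
  shows induced_map_cls:
      "p \<in> carrier (free_algebra K G') \<Longrightarrow>
        induced_map K G rel f (presented_class K G' rel' p) = cls (subst f p)"
    and induced_map_hom: "induced_map K G rel f \<in> algebra_hom K (presented_algebra K G' rel') Q"
proof -
  interpret D: presentation K G' rel' by fact
  have mem: "subst f p \<in> S" if "p \<in> D.S" for p
    using that f by (rule S_subst)
  have cls: "induced_map K G rel f (D.cls p) = cls (subst f p)" if "p \<in> D.S" for p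
    unfolding induced_map_def using that mem D.eqv_S subst_eqv[OF D f rel']
    by (intro D.Union_cls) (auto simp: cls_eq_iff)
  then show "p \<in> D.S \<Longrightarrow> induced_map K G rel f (D.cls p) = cls (subst f p)" .
  show "induced_map K G rel f \<in> algebra_hom K D.Q Q"
    unfolding algebra_hom_def Ring.ring_hom_def
    using mem by (auto simp: D.carrier_Q carrier_Q D.mult_Q mult_Q D.add_Q add_Q D.one_Q one_Q
        D.smult_Q smult_Q cls subst_simps)
qed

text \<open>Both sides are additive and multiplicative in \<open>p\<close> and agree on scalars, so
  generators decide.\<close>

lemma (in presentation) subst_eqv_self:
  assumes "\<And>g. g \<in> G \<Longrightarrow> subst f (h g) \<approx> generator g"
    and "p \<in> S"
  shows "subst f (subst h p) \<approx> p"
  using assms(2)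
  by (induction p rule: S_induct) (simp_all add: assms(1) subst_add subst_mult eqv_add eqv_mult)

text \<open>A substitution that respects the relations induces a homomorphism, and two such
  homomorphisms are mutually inverse as soon as they are so on generators. Bijectivity then follows
  from the two-sided inverse.\<close>

lemma presented_algebra_iso:
  fixes G :: "'g set" and G' :: "'h set"
  assumes "presentation K G rel" "presentation K G' rel'"
    and f: "\<And>a. a \<in> G \<Longrightarrow> f a \<in> carrier (free_algebra K G')"
    and g: "\<And>a. a \<in> G' \<Longrightarrow> g a \<in> carrier (free_algebra K G)"
    and frel: "\<And>x y. (x, y) \<in> rel \<Longrightarrow> presentation.eqv K G' rel' (subst f x) (subst f y)"
    and grel: "\<And>x y. (x, y) \<in> rel' \<Longrightarrow> presentation.eqv K G rel (subst g x) (subst g y)"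
    and gf: "\<And>a. a \<in> G \<Longrightarrow> presentation.eqv K G rel (subst g (f a)) (generator a)"
    and fg: "\<And>a. a \<in> G' \<Longrightarrow> presentation.eqv K G' rel' (subst f (g a)) (generator a)"
  obtains \<phi> \<psi> where
    "\<phi> \<in> algebra_iso K (presented_algebra K G rel) (presented_algebra K G' rel')"
    "\<psi> \<in> algebra_iso K (presented_algebra K G' rel') (presented_algebra K G rel)"
    "\<forall>x\<in>carrier (presented_algebra K G rel). \<psi> (\<phi> x) = x"
    "\<forall>y\<in>carrier (presented_algebra K G' rel'). \<phi> (\<psi> y) = y"
    "\<forall>p\<in>carrier (free_algebra K G).
      \<phi> (presented_class K G rel p) = presented_class K G' rel' (subst f p)"
    "\<forall>p\<in>carrier (free_algebra K G').
      \<psi> (presented_class K G' rel' p) = presented_class K G rel (subst g p)"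
proof -
  interpret D: presentation K G rel by fact
  interpret E: presentation K G' rel' by fact
  define \<phi> where "\<phi> = induced_map K G' rel' f"
  define \<psi> where "\<psi> = induced_map K G rel g"
  have \<phi>: "\<phi> (D.cls p) = E.cls (subst f p)" if "p \<in> D.S" for p
    unfolding \<phi>_def using that E.induced_map_cls[OF D.presentation_axioms f frel] by simp
  have \<psi>: "\<psi> (E.cls p) = D.cls (subst g p)" if "p \<in> E.S" for p
    unfolding \<psi>_def using that D.induced_map_cls[OF E.presentation_axioms g grel] by simp
  have mem: "subst f p \<in> E.S" if "p \<in> D.S" for p
    using E.S_subst[OF that f] .
  have mem': "subst g p \<in> D.S" if "p \<in> E.S" for p
    using D.S_subst[OF that g] .
  have \<psi>\<phi>: "\<psi> (\<phi> x) = x" if "x \<in> carrier D.Q" for x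
  proof -
    obtain p where p: "p \<in> D.S" "x = D.cls p"
      using \<open>x \<in> carrier D.Q\<close> by (auto simp: D.carrier_Q)
    then show ?thesis
      using mem mem' D.subst_eqv_self[where f = g and h = f, OF gf p(1)] D.cls_eq_iff
      by (simp add: \<phi> \<psi>)
  qed
  have \<phi>\<psi>: "\<phi> (\<psi> y) = y" if "y \<in> carrier E.Q" for y
  proof -
    obtain p where p: "p \<in> E.S" "y = E.cls p"
      using \<open>y \<in> carrier E.Q\<close> by (auto simp: E.carrier_Q)
    then show ?thesis
      using mem mem' E.subst_eqv_self[where f = f and h = g, OF fg p(1)] E.cls_eq_iff
      by (simp add: \<phi> \<psi>)
  qed
  have maps: "\<phi> \<in> carrier D.Q \<rightarrow> carrier E.Q" "\<psi> \<in> carrier E.Q \<rightarrow> carrier D.Q"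
    using mem mem' by (auto simp: D.carrier_Q E.carrier_Q \<phi> \<psi>)
  have "bij_betw \<phi> (carrier D.Q) (carrier E.Q)" "bij_betw \<psi> (carrier E.Q) (carrier D.Q)"
    using bij_betwI[OF maps \<psi>\<phi> \<phi>\<psi>] bij_betwI[OF maps(2,1) \<phi>\<psi> \<psi>\<phi>] by blast+
  then show thesis
    using that[of \<phi> \<psi>] \<phi> \<psi> \<psi>\<phi> \<phi>\<psi> E.induced_map_hom[OF D.presentation_axioms f frel]
      D.induced_map_hom[OF E.presentation_axioms g grel]
    by (simp add: algebra_iso_def \<phi>_def \<psi>_def)
qed

section \<open>The base ring and the adjugate matrix\<close>

lemma zeta_power: "zeta r ^ k = cis (2 * pi * real k / real r)"
  by (simp add: zeta_def cis_conv_exp field_simps flip: exp_of_nat_mult)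

lemma zeta_root: "r \<ge> 1 \<Longrightarrow> zeta r ^ r = 1"
  by (simp add: zeta_power)

lemma zeta_nonzero [simp]: "zeta r \<noteq> 0"
  by (simp add: zeta_def)

lemma zeta_power_inj:
  assumes "zeta r ^ i = zeta r ^ j" "i \<in> {1..r}" "j \<in> {1..r}"
  shows "i = j"
proof -
  have "inj_on (\<lambda>k. cis (2 * pi * real k / real r)) {..<r}"
    using bij_betw_roots_unity[of r] assms by (auto simp: bij_betw_def)
  then have inj: "inj_on (\<lambda>k. zeta r ^ k) {..<r}"
    by (simp add: zeta_power)
  \<comment> \<open>Exponents range over 1 to \<open>r\<close> here but over 0 to
    \<open>r - 1\<close> in \<open>inj\<close>; splitting off one factor \<open>zeta r\<close>
    bridges the shift.\<close>
  have "zeta r * zeta r ^ (i - 1) = zeta r * zeta r ^ (j - 1)"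
    using assms by (simp flip: power_Suc)
  then have "i - 1 = j - 1"
    using assms by (intro inj_onD[OF inj]) auto
  then show ?thesis
    using assms by auto
qed

lemma sum_powers_root:
  fixes a :: "'a::idom"
  assumes "a ^ r = 1"
  shows "(\<Sum>s<r. a ^ s) = (if a = 1 then of_nat r else 0)"
  using power_diff_1_eq[of a r] assms by (cases "a = 1") auto

section \<open>The matrix of roots of unity and its adjugate\<close>

lemma A_mat_carrier [simp]: "A_mat r \<in> carrier_mat r r"
  by (simp add: A_mat_def)

lemma A_mat_index: "i < r \<Longrightarrow> j < r \<Longrightarrow> A_mat r $$ (i, j) = zeta r ^ ((j + 1) * i)"
  by (simp add: A_mat_def)

lemma A_mat_dim [simp]: "dim_row (A_mat r) = r" "dim_col (A_mat r) = r"
  by (simp_all add: A_mat_def)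

text \<open>Discrete Fourier inversion exhibits a left inverse of \<open>A_mat r\<close>, so its
  determinant is a unit.\<close>

lemma Delta_nonzero:
  assumes r: "r \<ge> 1"
  shows "Delta r \<noteq> 0"
proof -
  \<comment> \<open>The entry is \<open>zeta^(-(j+1) i) / r\<close>; the factor \<open>r - 1\<close>
    in the exponent stands for -1, since \<open>zeta r ^ r = 1\<close>.\<close>
  define M where "M = mat r r (\<lambda>(j, i). zeta r ^ ((r - 1) * ((j + 1) * i)) / of_nat r)"
  have M: "M \<in> carrier_mat r r"
    by (simp add: M_def)
  have "M * A_mat r = 1\<^sub>m r"
  proof (rule eq_matI)
    fix j k assume jk: "j < dim_row (1\<^sub>m r :: complex mat)" "k < dim_col (1\<^sub>m r :: complex mat)"
    \<comment> \<open>This is \<open>zeta^(k - j)\<close>, so an entry of the product is a geometric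
      sum over an \<open>r\<close>-th root of unity that equals 1 only on the diagonal.\<close>
    define a where "a = zeta r ^ ((r - 1) * (j + 1)) * zeta r ^ (k + 1)"
    have a_mult: "a * zeta r ^ (j + 1) = zeta r ^ (k + 1)"
    proof -
      have "zeta r ^ ((r - 1) * (j + 1)) * zeta r ^ (j + 1) = (zeta r ^ r) ^ (j + 1)"
        using r by (cases r) (simp_all only: flip: power_add power_mult, simp_all add: algebra_simps)
      moreover have "a * zeta r ^ (j + 1) =
          zeta r ^ ((r - 1) * (j + 1)) * zeta r ^ (j + 1) * zeta r ^ (k + 1)"
        unfolding a_def by (simp only: ac_simps)
      ultimately show ?thesis
        by (simp only: zeta_root[OF r] power_one mult_1_left)
    qed
    have "a ^ r = (zeta r ^ r) ^ ((r - 1) * (j + 1)) * (zeta r ^ r) ^ (k + 1)"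
      by (simp add: a_def power_mult_distrib mult.commute flip: power_mult)
    then have root: "a ^ r = 1"
      by (simp add: zeta_root[OF r])
    have "a = 1 \<longleftrightarrow> j = k"
    proof
      assume "a = 1"
      then have "zeta r ^ (j + 1) = zeta r ^ (k + 1)"
        using a_mult by simp
      then show "j = k"
        using zeta_power_inj[of r "j + 1" "k + 1"] jk by auto
    next
      assume "j = k"
      then show "a = 1"
        using a_mult by simp
    qed
    moreover have "(M * A_mat r) $$ (j, k) = (\<Sum>i<r. a ^ i) / of_nat r"
    proof -
      have "M $$ (j, i) * A_mat r $$ (i, k) = a ^ i / of_nat r" if "i < r" for i
      proof -
        have "a ^ i = zeta r ^ ((r - 1) * (j + 1) * i) * zeta r ^ ((k + 1) * i)"
          unfolding a_def power_mult_distrib power_mult ..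
        moreover have "M $$ (j, i) = zeta r ^ ((r - 1) * ((j + 1) * i)) / of_nat r"
            "A_mat r $$ (i, k) = zeta r ^ ((k + 1) * i)"
          using jk that by (simp_all add: M_def A_mat_index)
        ultimately show ?thesis
          by (simp only: mult.assoc times_divide_eq_left)
      qed
      then show ?thesis
        using jk M by (simp add: scalar_prod_def sum_divide_distrib atLeast0LessThan)
    qed
    ultimately show "(M * A_mat r) $$ (j, k) = (1\<^sub>m r :: complex mat) $$ (j, k)"
      using jk r by (simp add: sum_powers_root[OF root])
  qed (simp_all add: M_def A_mat_def)
  then have "det M * Delta r = 1"
    using det_mult[OF M A_mat_carrier] by (simp add: Delta_def)
  then show ?thesis
    by auto
qed

text \<open>This is the adjugate identity \<open>B A = Delta 1\<close> read entrywise. It says that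
  \<open>F_i / Delta\<close> is the Lagrange polynomial of the node \<open>zeta^i\<close> among the
  \<open>r\<close>-th roots of unity.\<close>

lemma b_coeff_column:
  assumes "i \<in> {1..r}" "k \<in> {1..r}"
  shows "(\<Sum>j=1..r. b_coeff r i j * zeta r ^ (k * (j - 1))) = (if i = k then Delta r else 0)"
proof -
  have adj: "adj_mat (A_mat r) \<in> carrier_mat r r"
    using adj_mat(1)[OF A_mat_carrier] .
  have "(adj_mat (A_mat r) * A_mat r) $$ (i - 1, k - 1) = (Delta r \<cdot>\<^sub>m 1\<^sub>m r) $$ (i - 1, k - 1)"
    by (simp add: adj_mat(3)[OF A_mat_carrier] Delta_def)
  moreover have "(adj_mat (A_mat r) * A_mat r) $$ (i - 1, k - 1) =
      (\<Sum>j=0..<r. b_coeff r i (Suc j) * zeta r ^ (k * j))"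
    using assms adj by (auto simp: scalar_prod_def b_coeff_def A_mat_index intro!: sum.cong)
  moreover have "\<dots> = (\<Sum>j=1..r. b_coeff r i j * zeta r ^ (k * (j - 1)))"
    by (rule sum.reindex_bij_witness[of _ "\<lambda>j. j - 1" Suc]) auto
  moreover have "i - 1 = k - 1 \<longleftrightarrow> i = k"
    using assms by auto
  ultimately show ?thesis
    using assms by auto
qed

text \<open>The opposite product \<open>A B = Delta 1\<close>, read as the interpolation formula for
  the polynomial \<open>X^m\<close>: summing \<open>zeta^(i m) F_i\<close> over \<open>i\<close>
  gives \<open>Delta X^m\<close>.\<close>

lemma b_coeff_row:
  assumes "m < r" "j \<in> {1..r}"
  shows "(\<Sum>i=1..r. zeta r ^ (i * m) * b_coeff r i j) = (if j = m + 1 then Delta r else 0)"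
proof -
  have adj: "adj_mat (A_mat r) \<in> carrier_mat r r"
    using adj_mat(1)[OF A_mat_carrier] .
  have "(A_mat r * adj_mat (A_mat r)) $$ (m, j - 1) = (Delta r \<cdot>\<^sub>m 1\<^sub>m r) $$ (m, j - 1)"
    by (simp add: adj_mat(2)[OF A_mat_carrier] Delta_def)
  moreover have "(A_mat r * adj_mat (A_mat r)) $$ (m, j - 1) =
      (\<Sum>i=0..<r. zeta r ^ (Suc i * m) * b_coeff r (Suc i) j)"
    using assms adj by (auto simp: scalar_prod_def b_coeff_def A_mat_index intro!: sum.cong)
  moreover have "\<dots> = (\<Sum>i=1..r. zeta r ^ (i * m) * b_coeff r i j)"
    by (rule sum.reindex_bij_witness[of _ "\<lambda>j. j - 1" Suc]) auto
  moreover have "m = j - 1 \<longleftrightarrow> j = m + 1"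
    using assms by auto
  ultimately show ?thesis
    using assms by auto
qed

section \<open>Which constants lie in the base ring\<close>

lemma coefficient_ring_base: "coefficient_ring (base_ring r)"
proof
  have ops: "\<one>\<^bsub>ring_of_type_algebra\<^esub> = (1 :: complex fls)"
      "a \<oplus>\<^bsub>ring_of_type_algebra\<^esub> b = a + b" "a \<otimes>\<^bsub>ring_of_type_algebra\<^esub> b = a * b"
    for a b :: "complex fls"
    by (simp_all add: ring_of_type_algebra_def)
  interpret R: ring "ring_of_type_algebra :: complex fls ring"
    by (rule ring_from_type_algebra)
  have uminus: "\<ominus>\<^bsub>ring_of_type_algebra\<^esub> a = - a" for a :: "complex fls"
    by (rule R.minus_equality) (simp_all add: ring_of_type_algebra_def)
  show "1 \<in> base_ring r"
    unfolding base_ring_def ops(1)[symmetric] by (rule generate_ring.one)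
  fix a b assume ab: "a \<in> base_ring r" "b \<in> base_ring r"
  show "a * b \<in> base_ring r"
    using ab unfolding base_ring_def ops(3)[symmetric] by (rule generate_ring.eng_mult)
  have "a \<oplus>\<^bsub>ring_of_type_algebra\<^esub> (\<ominus>\<^bsub>ring_of_type_algebra\<^esub> b) \<in> base_ring r"
    using ab unfolding base_ring_def by (intro generate_ring.eng_add generate_ring.a_inv)
  then show "a - b \<in> base_ring r"
    by (simp add: ops uminus)
qed

lemma
  shows const_inverse_r_base: "fls_const (1 / of_nat r) \<in> base_ring r"
    and qvar_base: "qvar \<in> base_ring r"
    and inverse_qvar_base: "inverse qvar \<in> base_ring r"
    and const_zeta_base: "fls_const (zeta r) \<in> base_ring r"
    and const_inverse_Delta_base: "fls_const (inverse (Delta r)) \<in> base_ring r"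
  unfolding base_ring_def by (auto intro: generate_ring.incl)

text \<open>The base ring consists of Laurent series while \<open>A_mat\<close> is complex. Passing
  to the constants gives a subring of the complex numbers in which determinants can be
  formed.\<close>

lemma coefficient_ring_const_base: "coefficient_ring {c. fls_const c \<in> base_ring r}"
proof -
  interpret coefficient_ring "base_ring r" by (rule coefficient_ring_base)
  show ?thesis
    by unfold_locales (auto simp flip: fls_minus_const fls_const_mult_const)
qed

lemma (in coefficient_ring) det_mem_K:
  assumes "\<And>i j. i < dim_row M \<Longrightarrow> j < dim_col M \<Longrightarrow> M $$ (i, j) \<in> K"
  shows "det M \<in> K"
proof (cases "dim_row M = dim_col M")
  case True
  have "of_int (sign p) \<in> K" for p :: "nat \<Rightarrow> nat"
    by (auto simp: sign_def K_uminus)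
  with True assms show ?thesis
    unfolding det_def by (auto intro!: K_sum K_mult K_prod dest: permutes_in_image)
next
  \<comment> \<open>By convention \<open>det\<close> is 0 for a non-square matrix.\<close>
  case False
  then show ?thesis by (simp add: det_def)
qed

text \<open>Entries of the adjugate are cofactors, that is, signed minors, so they need only ring
  operations on powers of \<open>zeta r\<close>.\<close>

lemma const_b_coeff_base:
  assumes "i \<in> {1..r}" "j \<in> {1..r}"
  shows "fls_const (b_coeff r i j) \<in> base_ring r"
proof -
  interpret coefficient_ring "{c. fls_const c \<in> base_ring r}"
    by (rule coefficient_ring_const_base)
  have A_mem: "fls_const (A_mat r $$ (k, l)) \<in> base_ring r" if "k < r" "l < r" for k l
    using K_power[of "zeta r"] const_zeta_base that by (simp add: A_mat_index del: power_Suc)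
  have "det (mat_delete (A_mat r) (j - 1) (i - 1)) \<in> {c. fls_const c \<in> base_ring r}"
    by (intro det_mem_K) (auto simp: mat_delete_def intro!: A_mem)
  moreover have "(- 1) ^ m \<in> {c. fls_const c \<in> base_ring r}" for m
    by (intro K_power K_uminus K_one)
  ultimately have "cofactor (A_mat r) (j - 1) (i - 1) \<in> {c. fls_const c \<in> base_ring r}"
    unfolding cofactor_def by (intro K_mult)
  moreover have "b_coeff r i j = cofactor (A_mat r) (j - 1) (i - 1)"
    using assms by (auto simp: b_coeff_def adj_mat_def A_mat_def)
  ultimately show ?thesis
    by simp
qed

section \<open>Intertwining relations and simultaneous eigenvalues\<close>

context presentation
begin

lemma eqv_diff_0_iff: "p \<in> S \<Longrightarrow> q \<in> S \<Longrightarrow> p \<approx> q \<longleftrightarrow> p - q \<approx> 0"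
  by (auto simp: eqv_def)

lemma eqv_imp_diff_0: "p \<approx> q \<Longrightarrow> p - q \<approx> 0"
  by (auto simp: eqv_def)

text \<open>Turns a comparison of differences into an equivalence of relations, which can then be
  used once in each algebra and in opposite directions.\<close>

lemma eqv_iff_of_diff:
  assumes "p - q \<approx> p' - q'" "p \<in> S" "q \<in> S" "p' \<in> S" "q' \<in> S"
  shows "p \<approx> q \<longleftrightarrow> p' \<approx> q'"
  using eqv_diff_0_iff[OF assms(2,3)] eqv_diff_0_iff[OF assms(4,5)] assms(1)
    eqv_trans[OF assms(1)] eqv_trans[OF eqv_sym[OF assms(1)]] by blast

lemma eqv_left: "s \<in> S \<Longrightarrow> p \<approx> q \<Longrightarrow> s * p \<approx> s * q"
  by (rule eqv_mult) auto

lemma eqv_right: "s \<in> S \<Longrightarrow> p \<approx> q \<Longrightarrow> p * s \<approx> q * s"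
  by (rule eqv_mult) auto

text \<open>Closure under sums and products carries an interchange relation from torus elements to
  all polynomials in them. The instance \<open>twine p q q\<close> says that \<open>p\<close> and
  \<open>q\<close> commute modulo the relations.\<close>

definition twine :: "('g word \<Rightarrow>\<^sub>0 'k) \<Rightarrow> ('g word \<Rightarrow>\<^sub>0 'k) \<Rightarrow> ('g word \<Rightarrow>\<^sub>0 'k) \<Rightarrow> bool"
  where "twine T p p' \<longleftrightarrow> T \<in> S \<and> p \<in> S \<and> p' \<in> S \<and> T * p \<approx> p' * T"

lemma twine_S: assumes "twine T p p'" shows "T \<in> S" "p \<in> S" "p' \<in> S" "T * p \<approx> p' * T"
  using assms by (simp_all add: twine_def)

lemma twine_scalar: "T \<in> S \<Longrightarrow> c \<in> K \<Longrightarrow> twine T (scalar c) (scalar c)"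
  by (simp add: twine_def scalar_commute)

lemma twine_add: "twine T p p' \<Longrightarrow> twine T q q' \<Longrightarrow> twine T (p + q) (p' + q')"
  by (simp add: twine_def distrib_left distrib_right eqv_add)

lemma twine_diff: "twine T p p' \<Longrightarrow> twine T q q' \<Longrightarrow> twine T (p - q) (p' - q')"
  by (simp add: twine_def left_diff_distrib right_diff_distrib eqv_diff)

lemma twine_mult:
  assumes "twine T p p'" "twine T q q'"
  shows "twine T (p * q) (p' * q')"
proof -
  note S = twine_S[OF assms(1)] twine_S[OF assms(2)]
  have "T * (p * q) \<approx> (p' * T) * q"
    using eqv_right[OF S(6,4)] by (simp add: mult.assoc)
  also have "(p' * T) * q = p' * (T * q)"
    by (rule mult.assoc)
  also have "\<dots> \<approx> p' * (q' * T)"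
    using S by (intro eqv_left)
  finally show ?thesis
    using S by (simp add: twine_def mult.assoc)
qed

lemma twine_power: "twine T p p' \<Longrightarrow> twine T (p ^ m) (p' ^ m)"
proof (induction m)
  case 0
  then show ?case
    using twine_scalar[of T 1] by (simp add: twine_def)
qed (simp add: twine_mult)

lemma twine_sum:
  assumes "T \<in> S" "\<And>i. i \<in> J \<Longrightarrow> twine T (f i) (g i)"
  shows "twine T (sum f J) (sum g J)"
  using assms(2)
proof (induction J rule: infinite_finite_induct)
  case (insert i J)
  then show ?case by (simp add: twine_add)
qed (use twine_scalar[of T 0] assms(1) in simp_all)

lemma twine_commute: "twine p q q \<Longrightarrow> twine q p p"
  using eqv_sym[of "p * q" "q * p"] by (simp add: twine_def)

text \<open>Two elements with the same eigenvalues on a family that sums to one are congruent; this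
  reduces identities between commuting elements to identities between scalars.\<close>

definition acts :: "'c set \<Rightarrow> ('c \<Rightarrow> ('g word \<Rightarrow>\<^sub>0 'k)) \<Rightarrow> ('g word \<Rightarrow>\<^sub>0 'k) \<Rightarrow> ('c \<Rightarrow> 'k) \<Rightarrow> bool"
  where "acts J v p l \<longleftrightarrow> p \<in> S \<and> (\<forall>c\<in>J. l c \<in> K \<and> p * v c \<approx> scalar (l c) * v c)"

lemma actsD:
  assumes "acts J v p l"
  shows "p \<in> S" "c \<in> J \<Longrightarrow> l c \<in> K" "c \<in> J \<Longrightarrow> p * v c \<approx> scalar (l c) * v c"
  using assms by (simp_all add: acts_def)

lemma acts_eqv:
  assumes "acts J v p l" "acts J v q m" "\<And>c. c \<in> J \<Longrightarrow> l c = m c" "sum v J = 1"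
  shows "p \<approx> q"
proof -
  have "p = (\<Sum>c\<in>J. p * v c)"
    using assms(4) by (simp flip: sum_distrib_left)
  also have "\<dots> \<approx> (\<Sum>c\<in>J. scalar (l c) * v c)"
    using actsD[OF assms(1)] by (intro eqv_sum)
  also have "(\<Sum>c\<in>J. scalar (l c) * v c) = (\<Sum>c\<in>J. scalar (m c) * v c)"
    using assms(3) by simp
  also have "\<dots> \<approx> (\<Sum>c\<in>J. q * v c)"
    using eqv_sym[OF actsD(3)[OF assms(2)]] by (rule eqv_sum)
  also have "\<dots> = q"
    using assms(4) by (simp flip: sum_distrib_left)
  finally show ?thesis .
qed

lemma acts_scalar:
  "c \<in> K \<Longrightarrow> (\<And>i. i \<in> J \<Longrightarrow> v i \<in> S) \<Longrightarrow> acts J v (scalar c) (\<lambda>_. c)"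
  by (simp add: acts_def)

lemma acts_add: "acts J v p l \<Longrightarrow> acts J v q m \<Longrightarrow> acts J v (p + q) (\<lambda>c. l c + m c)"
  by (auto simp: acts_def scalar_add distrib_right eqv_add)

lemma acts_diff: "acts J v p l \<Longrightarrow> acts J v q m \<Longrightarrow> acts J v (p - q) (\<lambda>c. l c - m c)"
  by (auto simp: acts_def scalar_diff left_diff_distrib eqv_diff)

lemma acts_mult:
  assumes "acts J v p l" "acts J v q m"
  shows "acts J v (p * q) (\<lambda>c. l c * m c)"
  unfolding acts_def
proof (intro conjI ballI)
  fix c assume c: "c \<in> J"
  note P = actsD[OF assms(1)] actsD[OF assms(2)]
  show "l c * m c \<in> K"
    by (rule K_mult[OF P(2,5)[OF c]])
  have "p * q * v c \<approx> p * (scalar (m c) * v c)"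
    using P c by (simp add: mult.assoc eqv_left)
  also have "p * (scalar (m c) * v c) = scalar (m c) * (p * v c)"
    by (rule scalar_left_commute)
  also have "\<dots> \<approx> scalar (m c) * (scalar (l c) * v c)"
    using P c by (intro eqv_left) auto
  also have "\<dots> = scalar (l c * m c) * v c"
    by (simp only: mult.commute[of "l c"] scalar_mult mult.assoc)
  finally show "p * q * v c \<approx> scalar (l c * m c) * v c" .
qed (use assms actsD(1) in blast)

lemma acts_power:
  assumes "acts J v p l" "\<And>i. i \<in> J \<Longrightarrow> v i \<in> S"
  shows "acts J v (p ^ m) (\<lambda>c. l c ^ m)"
proof (induction m)
  case 0
  show ?case
    using acts_scalar[OF K_one assms(2)] by simp
next
  case (Suc m)
  show ?case
    using acts_mult[OF assms(1) Suc] by simp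
qed

lemma acts_sum:
  assumes "\<And>i. i \<in> B \<Longrightarrow> acts J v (f i) (g i)" "\<And>i. i \<in> J \<Longrightarrow> v i \<in> S"
  shows "acts J v (sum f B) (\<lambda>c. \<Sum>i\<in>B. g i c)"
  using assms(1)
proof (induction B rule: infinite_finite_induct)
  case (insert i B)
  then show ?case by (simp add: acts_add)
qed (use acts_scalar[OF K_zero assms(2)] in simp_all)

lemma acts_cong:
  "acts J v p l \<Longrightarrow> (\<And>c. c \<in> J \<Longrightarrow> l c = m c) \<Longrightarrow> acts J v p m"
  by (simp add: acts_def)

end

text \<open>The correction term for arbitrary arguments. The calculations also need it for
  interchanged arguments, for equal ones and for the outer pair of a triple.\<close>

definition FF :: "nat \<Rightarrow> falg \<Rightarrow> falg \<Rightarrow> falg"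
  where "FF r x y = scalar (fls_const (inverse (Delta r ^ 2)) * (qvar - inverse qvar)) *
    (\<Sum>(c1, c2) \<in> {(c1, c2). 1 \<le> c1 \<and> c1 < c2 \<and> c2 \<le> r}. F_eval r c1 x * F_eval r c2 y)"

definition weighted_FF :: "nat \<Rightarrow> falg \<Rightarrow> falg \<Rightarrow> falg"
  where "weighted_FF r x y = scalar (fls_const (inverse (Delta r ^ 2))) *
    (\<Sum>(c1, c2) \<in> {(c1, c2). 1 \<le> c1 \<and> c1 < c2 \<and> c2 \<le> r}.
       scalar (fls_const (zeta r ^ c2 - zeta r ^ c1) * (qvar - inverse qvar)) *
       F_eval r c1 x * F_eval r c2 y)"

definition e_poly :: "nat \<Rightarrow> falg \<Rightarrow> falg \<Rightarrow> falg"
  where "e_poly r x y = scalar (fls_const (1 / of_nat r)) * (\<Sum>s<r. x ^ s * (y ^ (r - 1)) ^ s)"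

lemma FF_sum_eq: "FF_sum r n i = FF r (tor n i) (tor n (i + 1))"
  by (simp add: FF_sum_def FF_def)

lemma weighted_FF_sum_eq: "weighted_FF_sum r n i = weighted_FF r (tor n i) (tor n (i + 1))"
  by (simp add: weighted_FF_sum_def weighted_FF_def)

lemma e_elt_eq: "e_elt r n i = e_poly r (tor n i) (tor n (i + 1))"
  by (simp add: e_elt_def e_poly_def)

abbreviation "zq \<equiv> qvar - inverse qvar"

locale torus_coefficients = coefficient_ring "base_ring r" G
  for r :: nat and G :: "gen set" +
  assumes r_pos: "r \<ge> 1"
begin

lemma const_base:
  "fls_const (zeta r ^ m) \<in> base_ring r" "zq \<in> base_ring r"
  "fls_const (inverse (Delta r ^ 2)) \<in> base_ring r"
  using K_power[OF const_zeta_base, of m] K_diff[OF qvar_base inverse_qvar_base]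
    K_power[OF const_inverse_Delta_base, of 2]
  by (simp_all only: fls_const_power flip: power_inverse)

lemma const_zeta_diff_base: "fls_const (zeta r ^ i - zeta r ^ j) * zq \<in> base_ring r"
  using K_mult[OF K_diff[OF const_base(1)[of i] const_base(1)[of j]] const_base(2)]
  by (simp add: fls_minus_const)

lemma F_eval_S:
  assumes "c \<in> {1..r}" "x \<in> S"
  shows "F_eval r c x \<in> S"
  unfolding F_eval_def using assms const_b_coeff_base by (intro S_sum S_mult S_scalar S_power) auto

lemma FF_S:
  assumes "x \<in> S" "y \<in> S"
  shows "FF r x y \<in> S"
  unfolding FF_def using assms F_eval_S const_base
  by (intro S_sum S_mult S_scalar K_mult) auto

lemma weighted_FF_S:
  assumes "x \<in> S" "y \<in> S"
  shows "weighted_FF r x y \<in> S"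
  unfolding weighted_FF_def using assms F_eval_S const_base const_zeta_diff_base
  by (intro S_sum S_mult S_scalar) auto

lemma e_poly_S:
  assumes "x \<in> S" "y \<in> S"
  shows "e_poly r x y \<in> S"
  unfolding e_poly_def using assms const_inverse_r_base
  by (intro S_sum S_mult S_scalar S_power)

end

section \<open>Eigenvalues of the correction terms\<close>

locale torus_presentation = presentation "base_ring r" G rel + torus_coefficients r G
  for r :: nat and G :: "gen set" and rel
begin

lemma twine_F_eval:
  assumes "c \<in> {1..r}" "twine T x x'"
  shows "twine T (F_eval r c x) (F_eval r c x')"
  unfolding F_eval_def using assms const_b_coeff_base twine_S[OF assms(2)]
  by (intro twine_sum twine_mult twine_scalar twine_power) auto

lemma twine_FF:
  assumes "twine T x x'" "twine T y y'"
  shows "twine T (FF r x y) (FF r x' y')"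
  unfolding FF_def using assms const_base twine_S[OF assms(1)]
  by (auto intro!: twine_sum twine_mult twine_scalar twine_F_eval K_mult)

text \<open>On an eigenvector a polynomial in \<open>x\<close> acts by its value at the eigenvalue,
  and \<open>b_coeff_column\<close> evaluates \<open>F_i\<close> at
  \<open>zeta^(k c)\<close>.\<close>

lemma acts_F_eval:
  assumes x: "acts J v x (\<lambda>c. fls_const (zeta r ^ k c))" and k: "\<And>c. c \<in> J \<Longrightarrow> k c \<in> {1..r}"
    and i: "i \<in> {1..r}" and v: "\<And>c. c \<in> J \<Longrightarrow> v c \<in> S"
  shows "acts J v (F_eval r i x) (\<lambda>c. if i = k c then fls_const (Delta r) else 0)"
proof -
  have "acts J v (F_eval r i x)
      (\<lambda>c. \<Sum>j=1..r. fls_const (b_coeff r i j) * fls_const (zeta r ^ k c) ^ (j - 1))"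
    unfolding F_eval_def using const_b_coeff_base i v
    by (intro acts_sum acts_mult acts_scalar acts_power x) auto
  moreover have "(\<Sum>j=1..r. fls_const (b_coeff r i j) * fls_const (zeta r ^ k c) ^ (j - 1)) =
      (if i = k c then fls_const (Delta r) else 0)" if "c \<in> J" for c
  proof -
    have sum: "(\<Sum>j\<in>B. fls_const (f j)) = fls_const (sum f B)" for f :: "nat \<Rightarrow> complex" and B
      by (induction B rule: infinite_finite_induct) (simp_all add: fls_plus_const)
    have "(\<Sum>j=1..r. fls_const (b_coeff r i j) * fls_const (zeta r ^ k c) ^ (j - 1)) =
        fls_const (\<Sum>j=1..r. b_coeff r i j * zeta r ^ (k c * (j - 1)))"
      by (simp add: power_mult flip: fls_const_power sum)
    also have "\<dots> = fls_const (if i = k c then Delta r else 0)"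
      using b_coeff_column[OF i k[OF that]] by simp
    finally show ?thesis
      by simp
  qed
  ultimately show ?thesis
    by (rule acts_cong)
qed

lemma const_Delta_square:
  "fls_const (inverse (Delta r ^ 2)) * (fls_const (Delta r) * fls_const (Delta r)) = 1"
  using Delta_nonzero[OF r_pos] by (simp add: power2_eq_square field_simps)

text \<open>On a common eigenvector only the pair \<open>(k c, m c)\<close> survives in the double
  sums, and only if it is increasing; \<open>Delta^(-2)\<close> cancels the two values of
  \<open>F\<close>. For \<open>e_poly\<close> the eigenvalue is an averaged geometric sum in
  \<open>zeta^(k c - m c)\<close>.\<close>

lemma
  assumes x: "acts J v x (\<lambda>c. fls_const (zeta r ^ k c))" "\<And>c. c \<in> J \<Longrightarrow> k c \<in> {1..r}"
    and y: "acts J v y (\<lambda>c. fls_const (zeta r ^ m c))" "\<And>c. c \<in> J \<Longrightarrow> m c \<in> {1..r}"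
    and v: "\<And>c. c \<in> J \<Longrightarrow> v c \<in> S"
  shows acts_FF: "acts J v (FF r x y) (\<lambda>c. if k c < m c then zq else 0)" (is ?FF)
    and acts_weighted_FF: "acts J v (weighted_FF r x y)
      (\<lambda>c. if k c < m c then fls_const (zeta r ^ m c - zeta r ^ k c) * zq else 0)" (is ?W)
    and acts_e_poly: "acts J v (e_poly r x y) (\<lambda>c. if k c = m c then 1 else 0)" (is ?e)
proof -
  let ?D = "fls_const (Delta r)" and ?C = "fls_const (inverse (Delta r ^ 2))"
  define P where "P = {(c1, c2). 1 \<le> c1 \<and> c1 < c2 \<and> c2 \<le> r}"
  define u where "u c p = (if fst p = k c then ?D else 0)" for c :: 'a and p :: "nat \<times> nat"
  define w where "w c p = (if snd p = m c then ?D else 0)" for c :: 'a and p :: "nat \<times> nat"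
  have fin: "finite P"
    by (rule finite_subset[of _ "{1..r} \<times> {1..r}"]) (auto simp: P_def)
  \<comment> \<open>The free weight \<open>f\<close> lets one computation serve both the plain and
    the weighted sum.\<close>
  have delta: "?C * (\<Sum>p\<in>P. f p * (u c p * w c p)) = (if k c < m c then f (k c, m c) else 0)"
    if "c \<in> J" for c f
  proof -
    have "(\<Sum>p\<in>P. f p * (u c p * w c p)) =
        (\<Sum>p\<in>P. if p = (k c, m c) then f (k c, m c) * (?D * ?D) else 0)"
      by (rule sum.cong) (auto simp: u_def w_def prod_eq_iff simp del: fls_const_mult_const)
    also have "\<dots> = (if k c < m c then f (k c, m c) * (?D * ?D) else 0)"
      using fin x(2)[OF that] y(2)[OF that] by (auto simp: P_def)
    also have "?C * \<dots> = (if k c < m c then f (k c, m c) * (?C * (?D * ?D)) else 0)"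
      using mult.left_commute[of ?C "f (k c, m c)" "?D * ?D"] by (cases "k c < m c") (simp_all only: if_True if_False mult_zero_right)
    finally show ?thesis
      by (simp only: const_Delta_square mult_1_right)
  qed
  have F: "acts J v (F_eval r (fst p) x) (\<lambda>c. u c p)"
      "acts J v (F_eval r (snd p) y) (\<lambda>c. w c p)" if "p \<in> P" for p
    using that by (auto simp: P_def u_def w_def intro!: acts_F_eval x y v)
  have "acts J v (FF r x y) (\<lambda>c. ?C * zq * (\<Sum>p\<in>P. u c p * w c p))"
    unfolding FF_def P_def[symmetric] case_prod_beta using F const_base v
    by (intro acts_mult acts_sum acts_scalar K_mult)
  moreover have "?C * zq * (\<Sum>p\<in>P. u c p * w c p) = (if k c < m c then zq else 0)" if "c \<in> J" for c
    using delta[OF that, of "\<lambda>_. zq"] by (simp only: sum_distrib_left mult.assoc)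
  ultimately show ?FF
    by (rule acts_cong)
  have "acts J v (weighted_FF r x y) (\<lambda>c. ?C *
      (\<Sum>p\<in>P. fls_const (zeta r ^ snd p - zeta r ^ fst p) * zq * u c p * w c p))"
    unfolding weighted_FF_def P_def[symmetric] case_prod_beta
    using F const_base const_zeta_diff_base v
    by (intro acts_mult acts_sum acts_scalar)
  moreover have "?C * (\<Sum>p\<in>P. fls_const (zeta r ^ snd p - zeta r ^ fst p) * zq * u c p * w c p) =
      (if k c < m c then fls_const (zeta r ^ m c - zeta r ^ k c) * zq else 0)" if "c \<in> J" for c
    using delta[OF that, of "\<lambda>p. fls_const (zeta r ^ snd p - zeta r ^ fst p) * zq"]
    by (simp only: mult.assoc fst_conv snd_conv)
  ultimately show ?W
    by (rule acts_cong)
  have "acts J v (e_poly r x y) (\<lambda>c. fls_const (1 / of_nat r) *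
      (\<Sum>s<r. fls_const (zeta r ^ k c) ^ s * (fls_const (zeta r ^ m c) ^ (r - 1)) ^ s))"
    unfolding e_poly_def using x y const_inverse_r_base v
    by (intro acts_mult acts_sum acts_scalar acts_power) auto
  moreover have "fls_const (1 / of_nat r) *
      (\<Sum>s<r. fls_const (zeta r ^ k c) ^ s * (fls_const (zeta r ^ m c) ^ (r - 1)) ^ s) =
      (if k c = m c then 1 else 0)" if "c \<in> J" for c
  proof -
    \<comment> \<open>The power \<open>r - 1\<close> plays the role of the inverse, so this is
      \<open>zeta^(k c - m c)\<close>.\<close>
    define a where "a = zeta r ^ k c * (zeta r ^ m c) ^ (r - 1)"
    have pow: "(zeta r ^ i) ^ r = 1" for i
      using zeta_root[OF r_pos] power_mult[of "zeta r" r i] power_mult[of "zeta r" i r]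
      by (simp add: mult.commute)
    have "a ^ r = (zeta r ^ k c) ^ r * (zeta r ^ (m c * (r - 1))) ^ r"
      by (simp only: a_def power_mult_distrib power_mult)
    then have root: "fls_const a ^ r = 1"
      by (simp only: pow mult_1_left fls_const_1 flip: fls_const_power)
    have "zeta r ^ m c * (zeta r ^ m c) ^ (r - 1) = 1"
      using pow[of "m c"] r_pos power_Suc[of "zeta r ^ m c" "r - 1"] by simp
    then have "a * zeta r ^ m c = zeta r ^ k c"
      by (simp add: a_def mult_ac)
    then have "a = 1 \<longleftrightarrow> k c = m c"
      using zeta_power_inj[of r "k c" "m c"] x(2)[OF that] y(2)[OF that] by auto
    moreover have "fls_const (zeta r ^ k c) ^ s * (fls_const (zeta r ^ m c) ^ (r - 1)) ^ s =
        fls_const a ^ s" for s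
      by (simp add: a_def fls_const_power flip: power_mult_distrib fls_const_mult_const)
    ultimately show ?thesis
      using sum_powers_root[OF root] r_pos by (simp add: fls_of_nat)
  qed
  ultimately show ?e
    by (rule acts_cong)
qed

section \<open>Spectral projections of torus elements\<close>

notation eqv (infix \<open>\<approx>\<close> 50)

definition root_idem :: "nat \<Rightarrow> falg \<Rightarrow> falg"
  where "root_idem c x = scalar (fls_const (inverse (Delta r))) * F_eval r c x"

lemma root_idem_S: "c \<in> {1..r} \<Longrightarrow> x \<in> S \<Longrightarrow> root_idem c x \<in> S"
  unfolding root_idem_def using F_eval_S const_inverse_Delta_base by (intro S_mult S_scalar)

lemma sum_const: "(\<Sum>j\<in>B. fls_const (f j :: complex)) = fls_const (sum f B)"
  by (induction B rule: infinite_finite_induct) (simp_all add: fls_plus_const)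

text \<open>Lagrange interpolation reproduces polynomials of degree below \<open>r\<close>, so this
  is an equality in the free algebra and not just a congruence. In degree 0 it says that the
  projections sum to 1.\<close>

lemma power_eq_sum_root_idem:
  assumes "m < r"
  shows "x ^ m = (\<Sum>c=1..r. scalar (fls_const (zeta r ^ (c * m))) * root_idem c x)"
proof -
  let ?d = "inverse (Delta r)"
  have "(\<Sum>c=1..r. scalar (fls_const (zeta r ^ (c * m))) * root_idem c x) =
      (\<Sum>c=1..r. \<Sum>j=1..r. scalar (fls_const (?d * (zeta r ^ (c * m) * b_coeff r c j))) * x ^ (j - 1))"
    unfolding root_idem_def F_eval_def sum_distrib_left
    by (simp only: mult.assoc[symmetric] mult.commute[of ?d] flip: scalar_mult fls_const_mult_const)
  also have "\<dots> = (\<Sum>j=1..r. \<Sum>c=1..r.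
      scalar (fls_const (?d * (zeta r ^ (c * m) * b_coeff r c j))) * x ^ (j - 1))"
    by (rule sum.swap)
  also have "\<dots> = (\<Sum>j=1..r. scalar (fls_const
      (?d * (\<Sum>c=1..r. zeta r ^ (c * m) * b_coeff r c j))) * x ^ (j - 1))"
    by (simp only: sum_distrib_left sum_distrib_right scalar_sum flip: sum_const)
  also have "\<dots> = (\<Sum>j=1..r. if j = m + 1 then x ^ m else 0)"
  proof (rule sum.cong)
    fix j assume j: "j \<in> {1..r}"
    show "scalar (fls_const (?d * (\<Sum>c=1..r. zeta r ^ (c * m) * b_coeff r c j))) * x ^ (j - 1) =
        (if j = m + 1 then x ^ m else 0)"
      unfolding b_coeff_row[OF assms j] using Delta_nonzero[OF r_pos] by auto
  qed simp
  also have "\<dots> = x ^ m"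
    using assms by simp
  finally show ?thesis by simp
qed

lemma sum_root_idem: "(\<Sum>c=1..r. root_idem c x) = 1"
  using power_eq_sum_root_idem[of 0 x] r_pos by simp

text \<open>Multiplying a projection by \<open>x\<close> raises its degree to \<open>r\<close>, one
  more than interpolation covers; in that degree \<open>x ^ r \<approx> 1\<close> reduces the claim
  to degree 0.\<close>

lemma power_eqv_sum_root_idem:
  assumes "x \<in> S" "x ^ r \<approx> 1" "m \<le> r"
  shows "x ^ m \<approx> (\<Sum>c=1..r. scalar (fls_const (zeta r ^ (c * m))) * root_idem c x)"
proof (cases "m = r")
  case True
  have "(\<Sum>c=1..r. scalar (fls_const (zeta r ^ (c * r))) * root_idem c x) = 1"
  proof -
    have "zeta r ^ (c * r) = 1" for c
      using zeta_root[OF r_pos] power_mult[of "zeta r" r c] by (simp add: mult.commute)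
    then show ?thesis
      using sum_root_idem[of x] by simp
  qed
  then show ?thesis
    using assms True by simp
next
  case False
  then show ?thesis
    using power_eq_sum_root_idem[of m x] eqv_refl[OF S_power[OF assms(1)], of m] assms(3) by simp
qed

text \<open>Each power of \<open>x\<close> in \<open>x * root_idem c x\<close> is expanded in
  projections again. The coefficient of \<open>root_idem i x\<close> becomes \<open>zeta^i\<close>
  times the value of the \<open>c\<close>-th Lagrange polynomial at \<open>zeta^i\<close>, which
  vanishes unless \<open>i = c\<close>.\<close>

lemma root_idem_eigen:
  assumes x: "x \<in> S" "x ^ r \<approx> 1" and c: "c \<in> {1..r}"
  shows "x * root_idem c x \<approx> scalar (fls_const (zeta r ^ c)) * root_idem c x"
proof -
  let ?d = "inverse (Delta r)"
  let ?s = "\<lambda>a. scalar (fls_const a)"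
  have d: "?s (?d * b_coeff r c j) \<in> S" if "j \<in> {1..r}" for j
    using K_mult[OF const_inverse_Delta_base const_b_coeff_base[OF c that]] by simp
  have "x * root_idem c x = (\<Sum>j=1..r. x * (?s (?d * b_coeff r c j) * x ^ (j - 1)))"
    unfolding root_idem_def F_eval_def sum_distrib_left
    by (simp only: scalar_mult mult.assoc flip: fls_const_mult_const)
  also have "\<dots> = (\<Sum>j=1..r. ?s (?d * b_coeff r c j) * x ^ j)"
  proof (rule sum.cong)
    fix j assume "j \<in> {1..r}"
    then have "x * x ^ (j - 1) = x ^ j"
      by (cases j) simp_all
    then show "x * (?s (?d * b_coeff r c j) * x ^ (j - 1)) = ?s (?d * b_coeff r c j) * x ^ j"
      by (simp only: scalar_left_commute[of x])
  qed simp
  \<comment> \<open>The exponent \<open>j\<close> reaches \<open>r\<close>; this last summand is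
    where \<open>x ^ r \<approx> 1\<close> enters.\<close>
  also have "\<dots> \<approx> (\<Sum>j=1..r. ?s (?d * b_coeff r c j) *
      (\<Sum>i=1..r. ?s (zeta r ^ (i * j)) * root_idem i x))"
    using x d power_eqv_sum_root_idem by (intro eqv_sum eqv_left) auto
  also have "\<dots> = (\<Sum>j=1..r. \<Sum>i=1..r.
      ?s (?d * zeta r ^ i * (b_coeff r c j * zeta r ^ (i * (j - 1)))) * root_idem i x)"
  proof (intro sum.cong refl, unfold sum_distrib_left, intro sum.cong refl)
    fix i j assume "j \<in> {1..r}"
    then have "zeta r ^ (i * j) = zeta r ^ i * zeta r ^ (i * (j - 1))"
      by (cases j) (simp_all add: power_add)
    then have "?d * b_coeff r c j * zeta r ^ (i * j) =
        ?d * zeta r ^ i * (b_coeff r c j * zeta r ^ (i * (j - 1)))"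
      by simp
    then show "?s (?d * b_coeff r c j) * (?s (zeta r ^ (i * j)) * root_idem i x) =
        ?s (?d * zeta r ^ i * (b_coeff r c j * zeta r ^ (i * (j - 1)))) * root_idem i x"
      by (simp only: mult.assoc[symmetric, of "?s (?d * b_coeff r c j)"] fls_const_mult_const
          flip: scalar_mult)
  qed
  also have "\<dots> = (\<Sum>i=1..r. \<Sum>j=1..r.
      ?s (?d * zeta r ^ i * (b_coeff r c j * zeta r ^ (i * (j - 1)))) * root_idem i x)"
    by (rule sum.swap)
  also have "\<dots> = (\<Sum>i=1..r. ?s (?d * zeta r ^ i * (\<Sum>j=1..r. b_coeff r c j * zeta r ^ (i * (j - 1))))
      * root_idem i x)"
    by (simp only: sum_distrib_left sum_distrib_right scalar_sum flip: sum_const)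
  also have "\<dots> = (\<Sum>i=1..r. if i = c then ?s (zeta r ^ c) * root_idem c x else 0)"
  proof (rule sum.cong)
    fix i assume i: "i \<in> {1..r}"
    have d: "?d * z * Delta r = z" for z
      using Delta_nonzero[OF r_pos] by simp
    show "?s (?d * zeta r ^ i * (\<Sum>j=1..r. b_coeff r c j * zeta r ^ (i * (j - 1)))) * root_idem i x =
        (if i = c then ?s (zeta r ^ c) * root_idem c x else 0)"
      unfolding b_coeff_column[OF c i]
      by (auto simp only: d mult_zero_right fls_const_0 scalar_0 mult_zero_left split: if_split)
  qed simp
  also have "\<dots> = ?s (zeta r ^ c) * root_idem c x"
    using c by simp
  finally show ?thesis .
qed

lemma twine_root_idem:
  "c \<in> {1..r} \<Longrightarrow> twine T x x' \<Longrightarrow> twine T (root_idem c x) (root_idem c x')"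
  unfolding root_idem_def
  by (intro twine_mult twine_scalar twine_F_eval const_inverse_Delta_base) (auto dest: twine_S)

text \<open>The eigenvectors are the products of one projection for each of the three elements.
  Commutation moves \<open>y\<close> and \<open>w\<close> past the projections on their left, and
  the three partitions of 1 multiply to one. Three elements suffice because a braid relation
  involves three torus elements.\<close>

lemma simultaneous_eigenvectors:
  assumes S: "x \<in> S" "y \<in> S" "w \<in> S"
    and root: "x ^ r \<approx> 1" "y ^ r \<approx> 1" "w ^ r \<approx> 1"
    and comm: "twine y x x" "twine w x x" "twine w y y"
  obtains v and J :: "(nat \<times> nat \<times> nat) set" and k1 k2 k3 where
    "sum v J = 1" "\<forall>c\<in>J. v c \<in> S"
    "acts J v x (\<lambda>c. fls_const (zeta r ^ k1 c))" "acts J v y (\<lambda>c. fls_const (zeta r ^ k2 c))"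
    "acts J v w (\<lambda>c. fls_const (zeta r ^ k3 c))"
    "\<forall>c\<in>J. k1 c \<in> {1..r} \<and> k2 c \<in> {1..r} \<and> k3 c \<in> {1..r}"
proof -
  let ?s = "\<lambda>a. scalar (fls_const a)"
  define J where "J = {1..r} \<times> {1..r} \<times> {1..r}"
  define v where "v = (\<lambda>(a, b, c). root_idem a x * (root_idem b y * root_idem c w))"
  have "sum v J = (\<Sum>a=1..r. \<Sum>b=1..r. \<Sum>c=1..r. root_idem a x * (root_idem b y * root_idem c w))"
    by (simp add: v_def J_def sum.cartesian_product)
  also have "\<dots> = 1"
    by (simp only: sum_root_idem mult_1_right flip: sum_distrib_left)
  finally have sum: "sum v J = 1" .
  have mem: "root_idem a x \<in> S" "root_idem a y \<in> S" "root_idem a w \<in> S" if "a \<in> {1..r}" for a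
    using root_idem_S that S by blast+
  \<comment> \<open>Passes an eigenvalue of \<open>p\<close> on \<open>t\<close> through a left
    factor \<open>s\<close> that commutes with \<open>p\<close>.\<close>
  have eig: "p * (s * t) \<approx> ?s l * (s * t)"
    if "twine p s s" "p * t \<approx> ?s l * t" "t \<in> S" for p s t l
  proof -
    note P = twine_S[OF that(1)]
    have "p * (s * t) \<approx> s * p * t"
      using eqv_right[OF that(3) P(4)] by (simp add: mult.assoc)
    also have "s * p * t \<approx> s * (?s l * t)"
      using eqv_left[OF P(2) that(2)] by (simp add: mult.assoc)
    also have "\<dots> = ?s l * (s * t)"
      by (rule scalar_left_commute)
    finally show ?thesis .
  qed
  have "acts J v x (\<lambda>c. fls_const (zeta r ^ fst c))"
    unfolding acts_def
  proof (intro conjI ballI)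
    fix c assume "c \<in> J"
    then obtain a b d where c: "c = (a, b, d)" "a \<in> {1..r}" "b \<in> {1..r}" "d \<in> {1..r}"
      by (auto simp: J_def)
    have "x * root_idem a x * (root_idem b y * root_idem d w) \<approx>
        ?s (zeta r ^ a) * root_idem a x * (root_idem b y * root_idem d w)"
      using mem c S root by (intro eqv_right root_idem_eigen S_mult)
    then show "x * v c \<approx> ?s (zeta r ^ fst c) * v c"
      by (simp add: v_def c mult.assoc)
  qed (use S const_base in auto)
  moreover have "acts J v y (\<lambda>c. fls_const (zeta r ^ fst (snd c)))"
    unfolding acts_def
  proof (intro conjI ballI)
    fix c assume "c \<in> J"
    then obtain a b d where c: "c = (a, b, d)" "a \<in> {1..r}" "b \<in> {1..r}" "d \<in> {1..r}"
      by (auto simp: J_def)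
    have "y * root_idem b y * root_idem d w \<approx> ?s (zeta r ^ b) * root_idem b y * root_idem d w"
      using mem c S root by (intro eqv_right root_idem_eigen S_mult)
    then show "y * v c \<approx> ?s (zeta r ^ fst (snd c)) * v c"
      using eig[OF twine_root_idem[OF c(2) comm(1)], of "root_idem b y * root_idem d w"] mem c
      by (simp add: v_def mult.assoc)
  qed (use S const_base in auto)
  moreover have "acts J v w (\<lambda>c. fls_const (zeta r ^ snd (snd c)))"
    unfolding acts_def
  proof (intro conjI ballI)
    fix c assume "c \<in> J"
    then obtain a b d where c: "c = (a, b, d)" "a \<in> {1..r}" "b \<in> {1..r}" "d \<in> {1..r}"
      by (auto simp: J_def)
    have "w * (root_idem b y * root_idem d w) \<approx> ?s (zeta r ^ d) * (root_idem b y * root_idem d w)"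
      using mem c root_idem_eigen[OF S(3) root(3) c(4)] twine_root_idem[OF c(3) comm(3)] by (intro eig)
    then show "w * v c \<approx> ?s (zeta r ^ snd (snd c)) * v c"
      using eig[OF twine_root_idem[OF c(2) comm(2)], of "root_idem b y * root_idem d w"] mem c
      by (simp add: v_def)
  qed (use S const_base in auto)
  moreover have "v c \<in> S" if "c \<in> J" for c
    using that mem by (auto simp: J_def v_def)
  ultimately show thesis
    using sum by (intro that[of v J fst "fst \<circ> snd" "snd \<circ> snd"]) (auto simp: J_def)
qed

text \<open>On eigenvalues \<open>FF\<close> is \<open>zq\<close> times the indicator of
  \<open>k < m\<close>. The partition is the trichotomy of \<open>k\<close> and \<open>m\<close>,
  and the two multiplication rules hold because \<open>weighted_FF\<close> acts like
  \<open>(y - x) * FF r x y\<close>.\<close>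

lemma
  assumes S: "x \<in> S" "y \<in> S" and root: "x ^ r \<approx> 1" "y ^ r \<approx> 1" and comm: "twine y x x"
  shows FF_square: "FF r x y * FF r x y \<approx> scalar zq * FF r x y"
    and FF_partition: "scalar zq * e_poly r x y + FF r y x + FF r x y \<approx> scalar zq"
    and FF_times_left: "FF r x y * x \<approx> y * FF r x y - weighted_FF r x y"
    and FF_times_right: "FF r x y * y \<approx> x * FF r x y + weighted_FF r x y"
    and FF_diag: "FF r x x \<approx> 0"
    and e_poly_diag: "e_poly r x x \<approx> 1"
proof -
  have xx: "twine x x x"
    using S by (simp add: twine_def)
  \<comment> \<open>The pair is completed to a triple by taking \<open>x\<close> a second
    time.\<close>
  obtain v and J :: "(nat \<times> nat \<times> nat) set" and k m k3 where
    v1: "sum v J = 1" and v': "\<forall>c\<in>J. v c \<in> S"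
    and x: "acts J v x (\<lambda>c. fls_const (zeta r ^ k c))"
    and y: "acts J v y (\<lambda>c. fls_const (zeta r ^ m c))"
    and "acts J v x (\<lambda>c. fls_const (zeta r ^ k3 c))"
    and k': "\<forall>c\<in>J. k c \<in> {1..r} \<and> m c \<in> {1..r} \<and> k3 c \<in> {1..r}"
    by (rule simultaneous_eigenvectors[OF S S(1) root root(1) comm xx twine_commute[OF comm]],
        rule that, assumption+)
  have v: "sum v J = 1" "\<And>c. c \<in> J \<Longrightarrow> v c \<in> S"
    and k: "\<And>c. c \<in> J \<Longrightarrow> k c \<in> {1..r}" "\<And>c. c \<in> J \<Longrightarrow> m c \<in> {1..r}"
    using v1 v' k' by blast+
  note N = acts_FF[OF x k(1) y k(2) v(2)]
  note N' = acts_FF[OF y k(2) x k(1) v(2)]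
  note e = acts_e_poly[OF x k(1) y k(2) v(2)]
  note W = acts_weighted_FF[OF x k(1) y k(2) v(2)]
  note Z = acts_scalar[OF const_base(2), of J v, OF v(2)]
  show "FF r x y * FF r x y \<approx> scalar zq * FF r x y"
    by (rule acts_eqv[OF acts_mult[OF N N] acts_mult[OF Z N] _ v(1)]) simp_all
  show "scalar zq * e_poly r x y + FF r y x + FF r x y \<approx> scalar zq"
    by (rule acts_eqv[OF acts_add[OF acts_add[OF acts_mult[OF Z e] N'] N] Z _ v(1)]) auto
  show "FF r x y * x \<approx> y * FF r x y - weighted_FF r x y"
    by (rule acts_eqv[OF acts_mult[OF N x] acts_diff[OF acts_mult[OF y N] W] _ v(1)])
      (simp_all add: left_diff_distrib right_diff_distrib mult.commute flip: fls_minus_const)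
  show "FF r x y * y \<approx> x * FF r x y + weighted_FF r x y"
    by (rule acts_eqv[OF acts_mult[OF N y] acts_add[OF acts_mult[OF x N] W] _ v(1)])
      (simp_all add: left_diff_distrib right_diff_distrib mult.commute flip: fls_minus_const)
  show "FF r x x \<approx> 0"
    using acts_eqv[OF acts_FF[OF x k(1) x k(1) v(2)] acts_scalar[OF K_zero v(2)] _ v(1)] by simp
  show "e_poly r x x \<approx> 1"
    using acts_eqv[OF acts_e_poly[OF x k(1) x k(1) v(2)] acts_scalar[OF K_one v(2)] _ v(1)] by simp
qed

text \<open>Up to \<open>zq\<close> squared, the first identity says that \<open>k3\<close> exceeds
  both \<open>k1\<close> and \<open>k2\<close> exactly when it exceeds the larger one, and the left
  side splits this by comparing \<open>k1\<close> with \<open>k2\<close>. The second says the same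
  of \<open>k1\<close> lying below the smaller of \<open>k2\<close> and \<open>k3\<close>. In the
  third, both sides are \<open>zq\<close> cubed times the indicator of
  \<open>k1 < k2 < k3\<close>.\<close>

lemma
  assumes S: "x \<in> S" "y \<in> S" "w \<in> S"
    and root: "x ^ r \<approx> 1" "y ^ r \<approx> 1" "w ^ r \<approx> 1"
    and comm: "twine y x x" "twine w x x" "twine w y y"
  shows FF_triple_left:
      "FF r x w * (scalar zq * e_poly r x y) + FF r x y * FF r y w + FF r x w * FF r y x
        \<approx> FF r y w * FF r x w"
    and FF_triple_right:
      "FF r x w * (scalar zq * e_poly r y w) + FF r y w * FF r x y + FF r x w * FF r w y
        \<approx> FF r x y * FF r x w"
    and FF_triple_braid:
      "FF r x y * FF r y w * FF r x y \<approx> FF r y w * FF r x y * FF r y w"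
proof -
  obtain v and J :: "(nat \<times> nat \<times> nat) set" and k1 k2 k3 where
    v1: "sum v J = 1" and v': "\<forall>c\<in>J. v c \<in> S"
    and x: "acts J v x (\<lambda>c. fls_const (zeta r ^ k1 c))"
    and y: "acts J v y (\<lambda>c. fls_const (zeta r ^ k2 c))"
    and w: "acts J v w (\<lambda>c. fls_const (zeta r ^ k3 c))"
    and k': "\<forall>c\<in>J. k1 c \<in> {1..r} \<and> k2 c \<in> {1..r} \<and> k3 c \<in> {1..r}"
    by (rule simultaneous_eigenvectors[OF S root comm], rule that, assumption+)
  have v: "sum v J = 1" "\<And>c. c \<in> J \<Longrightarrow> v c \<in> S"
    and k: "\<And>c. c \<in> J \<Longrightarrow> k1 c \<in> {1..r}" "\<And>c. c \<in> J \<Longrightarrow> k2 c \<in> {1..r}"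
      "\<And>c. c \<in> J \<Longrightarrow> k3 c \<in> {1..r}"
    using v1 v' k' by blast+
  note xy = acts_FF[OF x k(1) y k(2) v(2)] and yx = acts_FF[OF y k(2) x k(1) v(2)]
  note yw = acts_FF[OF y k(2) w k(3) v(2)] and wy = acts_FF[OF w k(3) y k(2) v(2)]
  note xw = acts_FF[OF x k(1) w k(3) v(2)]
  note e1 = acts_e_poly[OF x k(1) y k(2) v(2)] and e2 = acts_e_poly[OF y k(2) w k(3) v(2)]
  note Z = acts_scalar[OF const_base(2), of J v, OF v(2)]
  show "FF r x w * (scalar zq * e_poly r x y) + FF r x y * FF r y w + FF r x w * FF r y x
        \<approx> FF r y w * FF r x w"
    by (rule acts_eqv[OF acts_add[OF acts_add[OF acts_mult[OF xw acts_mult[OF Z e1]]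
            acts_mult[OF xy yw]] acts_mult[OF xw yx]] acts_mult[OF yw xw] _ v(1)]) auto
  show "FF r x w * (scalar zq * e_poly r y w) + FF r y w * FF r x y + FF r x w * FF r w y
        \<approx> FF r x y * FF r x w"
    by (rule acts_eqv[OF acts_add[OF acts_add[OF acts_mult[OF xw acts_mult[OF Z e2]]
            acts_mult[OF yw xy]] acts_mult[OF xw wy]] acts_mult[OF xy xw] _ v(1)]) auto
  show "FF r x y * FF r y w * FF r x y \<approx> FF r y w * FF r x y * FF r y w"
    by (rule acts_eqv[OF acts_mult[OF acts_mult[OF xy yw] xy]
            acts_mult[OF acts_mult[OF yw xy] yw] _ v(1)]) auto
qed

section \<open>Effect of the shift on the quadratic, braid, commutation and torus relations\<close>

lemma quadratic_shift:
  assumes xy: "twine y x x" "x ^ r \<approx> 1" "y ^ r \<approx> 1" and T: "twine T x y" "twine T y x"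
  shows "(T + FF r x y)\<^sup>2 - scalar zq * (T + FF r x y) \<approx> T\<^sup>2 - scalar zq * e_poly r x y * T"
proof -
  note S = twine_S[OF T(1)]
  define N where "N = FF r x y"
  define N' where "N' = FF r y x"
  define e where "e = scalar zq * e_poly r x y"
  define Z :: falg where "Z = scalar zq"
  note defs = N_def N'_def e_def Z_def
  have mem: "N \<in> S" "N' \<in> S" "e \<in> S" "Z \<in> S" "T \<in> S"
    using S const_base by (auto simp: defs intro!: FF_S e_poly_S)
  have TN: "T * N \<approx> N' * T"
    using twine_FF[OF T] by (simp add: defs twine_S)
  have NN: "N * N \<approx> Z * N"
    unfolding defs using S xy by (intro FF_square)
  have "e + N' + N \<approx> Z"
    unfolding defs using S xy by (intro FF_partition)
  then have "e \<approx> Z - (N' + N)"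
    using eqv_diff[of "e + N' + N" Z "N' + N" "N' + N"] mem by (simp add: algebra_simps)
  then have e: "T * T - e * T \<approx> T * T - (Z - (N' + N)) * T"
    using mem by (intro eqv_diff eqv_right eqv_refl) auto
  have "(T + N)\<^sup>2 - Z * (T + N) = T * T + T * N + N * T + N * N - Z * T - Z * N"
    by (simp add: power2_eq_square algebra_simps)
  also have "\<dots> \<approx> T * T + N' * T + N * T + Z * N - Z * T - Z * N"
    using mem TN NN by (intro eqv_diff eqv_add eqv_refl) auto
  also have "\<dots> = T * T - (Z - (N' + N)) * T"
    by (simp add: algebra_simps)
  also have "\<dots> \<approx> T * T - e * T"
    by (rule eqv_sym[OF e])
  finally show ?thesis
    by (simp add: defs power2_eq_square)
qed

text \<open>Covers \<open>n = 1\<close>, where both torus arguments coincide: the correction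
  vanishes and \<open>e_poly\<close> becomes 1, so the shift changes nothing.\<close>

lemma quadratic_shift_diag:
  assumes x: "x \<in> S" "x ^ r \<approx> 1" and T: "T \<in> S"
  shows "(T + FF r x x)\<^sup>2 - scalar zq * (T + FF r x x) \<approx> T\<^sup>2 - scalar zq * e_poly r x x * T"
proof -
  have xx: "twine x x x"
    using x by (simp add: twine_def)
  have "T + FF r x x \<approx> T + 0"
    using T FF_diag[OF x(1,1,2,2) xx] by (intro eqv_add) auto
  then have "(T + FF r x x)\<^sup>2 - scalar zq * (T + FF r x x) \<approx> T\<^sup>2 - scalar zq * T"
    using const_base by (intro eqv_diff eqv_power eqv_left) auto
  moreover have "scalar zq * e_poly r x x * T \<approx> scalar zq * 1 * T"
    using e_poly_diag[OF x(1,1,2,2) xx] T const_base by (intro eqv_left eqv_right) auto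
  then have "T\<^sup>2 - scalar zq * e_poly r x x * T \<approx> T\<^sup>2 - scalar zq * T"
    using T by (intro eqv_diff) auto
  ultimately show ?thesis
    using eqv_trans[OF _ eqv_sym] by blast
qed

text \<open>Expand both products and move all torus factors to the left. The terms
  \<open>a * B * a\<close> and \<open>b * A * b\<close> then contain squares, which is why the
  quadratic relations are assumed. The coefficients of the remaining short words are matched by the
  triple identities, leaving only \<open>a * b * a\<close> and \<open>b * a * b\<close>.\<close>

lemma braid_shift:
  assumes S: "x \<in> S" "y \<in> S" "w \<in> S"
    and root: "x ^ r \<approx> 1" "y ^ r \<approx> 1" "w ^ r \<approx> 1"
    and comm: "twine y x x" "twine w x x" "twine w y y"
    and a: "twine a x y" "twine a y x" "twine a w w"
    and b: "twine b x x" "twine b y w" "twine b w y"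
    and a2: "a\<^sup>2 \<approx> 1 + scalar zq * e_poly r x y * a"
    and b2: "b\<^sup>2 \<approx> 1 + scalar zq * e_poly r y w * b"
  shows "(a + FF r x y) * (b + FF r y w) * (a + FF r x y)
      - (b + FF r y w) * (a + FF r x y) * (b + FF r y w) \<approx> a * b * a - b * a * b"
proof -
  define A where "A = FF r x y"
  define A' where "A' = FF r y x"
  define B where "B = FF r y w"
  define B' where "B' = FF r w y"
  define C where "C = FF r x w"
  define e where "e = scalar zq * e_poly r x y"
  define f where "f = scalar zq * e_poly r y w"
  note defs = A_def A'_def B_def B'_def C_def e_def f_def
  have mem [simp]: "A \<in> S" "A' \<in> S" "B \<in> S" "B' \<in> S" "C \<in> S" "e \<in> S" "f \<in> S" "a \<in> S" "b \<in> S"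
    using S const_base twine_S[OF a(1)] twine_S[OF b(1)] by (auto simp: defs intro!: FF_S e_poly_S)
  have aA: "a * A \<approx> A' * a" and aB: "a * B \<approx> C * a" and aC: "a * C \<approx> B * a"
    unfolding defs by (intro twine_S(4) twine_FF a)+
  have bA: "b * A \<approx> C * b" and bB: "b * B \<approx> B' * b" and bC: "b * C \<approx> A * b"
    unfolding defs by (intro twine_S(4) twine_FF b)+
  have sq: "a * a \<approx> 1 + e * a" "b * b \<approx> 1 + f * b"
    using a2 b2 by (simp_all add: defs power2_eq_square)
  have "C * e + A * B + C * A' \<approx> B * C"
    unfolding defs using S root comm by (rule FF_triple_left)
  then have left: "(C * e + A * B + C * A') * a \<approx> B * C * a"
    by (intro eqv_right) auto
  have "C * f + B * A + C * B' \<approx> A * C"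
    unfolding defs using S root comm by (rule FF_triple_right)
  then have right: "(C * f + B * A + C * B') * b \<approx> A * C * b"
    by (intro eqv_right) auto
  have aba: "A * B * A \<approx> B * A * B"
    unfolding defs using S root comm by (rule FF_triple_braid)
  \<comment> \<open>Moving \<open>B\<close> to the left past \<open>a\<close> turns it into
    \<open>C\<close> and brings the two factors \<open>a\<close> together.\<close>
  have aBa: "a * B * a \<approx> C + C * e * a"
  proof -
    have "a * B * a \<approx> C * (a * a)"
      using eqv_right[OF _ aB, of a] by (simp add: mult.assoc)
    also have "\<dots> \<approx> C * (1 + e * a)"
      using sq by (intro eqv_left) auto
    finally show ?thesis by (simp add: algebra_simps)
  qed
  have bAb: "b * A * b \<approx> C + C * f * b"
  proof -
    have "b * A * b \<approx> C * (b * b)"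
      using eqv_right[OF _ bA, of b] by (simp add: mult.assoc)
    also have "\<dots> \<approx> C * (1 + f * b)"
      using sq by (intro eqv_left) auto
    finally show ?thesis by (simp add: algebra_simps)
  qed
  have abA: "a * b * A \<approx> B * a * b"
  proof -
    have "a * b * A \<approx> a * C * b"
      using eqv_left[OF _ bA, of a] by (simp add: mult.assoc)
    also have "a * C * b \<approx> B * a * b"
      using aC by (intro eqv_right) auto
    finally show ?thesis .
  qed
  have baB: "b * a * B \<approx> A * b * a"
  proof -
    have "b * a * B \<approx> b * C * a"
      using eqv_left[OF _ aB, of b] by (simp add: mult.assoc)
    also have "b * C * a \<approx> A * b * a"
      using bC by (intro eqv_right) auto
    finally show ?thesis .
  qed
  have aBA: "a * B * A \<approx> C * A' * a"
  proof -
    have "a * B * A \<approx> C * a * A"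
      using aB by (intro eqv_right) auto
    also have "C * a * A \<approx> C * A' * a"
      using eqv_left[OF _ aA, of C] by (simp add: mult.assoc)
    finally show ?thesis .
  qed
  have bAB: "b * A * B \<approx> C * B' * b"
  proof -
    have "b * A * B \<approx> C * b * B"
      using bA by (intro eqv_right) auto
    also have "C * b * B \<approx> C * B' * b"
      using eqv_left[OF _ bB, of C] by (simp add: mult.assoc)
    finally show ?thesis .
  qed
  have AbA: "A * b * A \<approx> A * C * b" and BaB: "B * a * B \<approx> B * C * a"
    using eqv_left[OF _ bA, of A] eqv_left[OF _ aB, of B] by (simp_all add: mult.assoc)
  have "(a + A) * (b + B) * (a + A) =
      a * b * a + A * b * a + a * B * a + a * b * A + A * B * a + A * b * A + a * B * A + A * B * A"
    by (simp add: algebra_simps)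
  also have "\<dots> \<approx>
      a * b * a + A * b * a + (C + C * e * a) + B * a * b + A * B * a + A * C * b + C * A' * a + A * B * A"
    using aBa abA AbA aBA by (intro eqv_add eqv_refl) auto
  also have "\<dots> = a * b * a + (A * b * a + B * a * b + C + A * C * b)
      + (C * e + A * B + C * A') * a + A * B * A"
    by (simp add: algebra_simps)
  \<comment> \<open>All terms with a single \<open>a\<close> collapse to \<open>B * C * a\<close>,
    which is what \<open>B * a * B\<close> contributes to the other product. In the same way the
    terms with a single \<open>b\<close> there collapse to the \<open>A * C * b\<close> present
    here.\<close>
  also have "\<dots> \<approx> a * b * a + (A * b * a + B * a * b + C + A * C * b) + B * C * a + A * B * A"
    using left by (intro eqv_add eqv_refl) auto
  finally have L: "(a + A) * (b + B) * (a + A) \<approx>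
    a * b * a + (A * b * a + B * a * b + C + A * C * b) + B * C * a + A * B * A" .
  have "(b + B) * (a + A) * (b + B) =
      b * a * b + B * a * b + b * A * b + b * a * B + B * A * b + B * a * B + b * A * B + B * A * B"
    by (simp add: algebra_simps)
  also have "\<dots> \<approx>
      b * a * b + B * a * b + (C + C * f * b) + A * b * a + B * A * b + B * C * a + C * B' * b + A * B * A"
    using bAb baB BaB bAB eqv_sym[OF aba] by (intro eqv_add eqv_refl) auto
  also have "\<dots> = b * a * b + (A * b * a + B * a * b + C) + B * C * a
      + (C * f + B * A + C * B') * b + A * B * A"
    by (simp add: algebra_simps)
  also have "\<dots> \<approx> b * a * b + (A * b * a + B * a * b + C) + B * C * a + A * C * b + A * B * A"
    using right by (intro eqv_add eqv_refl) auto
  finally have R: "(b + B) * (a + A) * (b + B) \<approx>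
    b * a * b + (A * b * a + B * a * b + C) + B * C * a + A * C * b + A * B * A" .
  show ?thesis
    using eqv_diff[OF L R] unfolding defs[symmetric] by (simp add: algebra_simps)
qed

lemma commute_shift:
  assumes "N \<in> S" "N' \<in> S" "twine a N' N'" "twine b N N" "twine N N' N'"
  shows "(a + N) * (b + N') - (b + N') * (a + N) \<approx> a * b - b * a"
proof -
  have S: "a \<in> S" "b \<in> S"
    using assms by (auto dest: twine_S)
  have "(a + N) * (b + N') - (b + N') * (a + N) =
      a * b - b * a + (a * N' - N' * a) - (b * N - N * b) + (N * N' - N' * N)"
    by (simp add: algebra_simps)
  also have "\<dots> \<approx> a * b - b * a + 0 - 0 + 0"
    using S by (intro eqv_add eqv_diff eqv_imp_diff_0 twine_S(4) assms(3-)) auto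
  finally show ?thesis by simp
qed

text \<open>The shift enters linearly, so its contribution separates from that of \<open>T\<close>
  and vanishes by the multiplication rules for \<open>FF\<close>.\<close>

lemma
  assumes xy: "twine y x x" "x ^ r \<approx> 1" "y ^ r \<approx> 1" and T: "T \<in> S"
  shows shift_times_left:
      "(T + FF r x y) * x - (y * (T + FF r x y) - weighted_FF r x y) \<approx> T * x - y * T" (is ?l)
    and shift_times_right:
      "(T + FF r x y) * y - (x * (T + FF r x y) + weighted_FF r x y) \<approx> T * y - x * T" (is ?r)
proof -
  note S = twine_S[OF xy(1)]
  note mem = FF_S[OF S(2,1)] weighted_FF_S[OF S(2,1)]
  have "(T + FF r x y) * x - (y * (T + FF r x y) - weighted_FF r x y) =
      T * x - y * T + (FF r x y * x - (y * FF r x y - weighted_FF r x y))"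
    by (simp add: algebra_simps)
  also have "\<dots> \<approx> T * x - y * T + 0"
    using S T by (intro eqv_add eqv_imp_diff_0 FF_times_left[OF S(2,1) xy(2,3,1)]) auto
  finally show ?l by simp
  have "(T + FF r x y) * y - (x * (T + FF r x y) + weighted_FF r x y) =
      T * y - x * T + (FF r x y * y - (x * FF r x y + weighted_FF r x y))"
    by (simp add: algebra_simps)
  also have "\<dots> \<approx> T * y - x * T + 0"
    using S T by (intro eqv_add eqv_imp_diff_0 FF_times_right[OF S(2,1) xy(2,3,1)]) auto
  finally show ?r by simp
qed

end

section \<open>The affine presentations\<close>

text \<open>An index divisible by \<open>n\<close> is sent to \<open>tor n 0\<close>, which is \<open>tor n n\<close>.\<close>

definition ctor :: "nat \<Rightarrow> int \<Rightarrow> falg"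
  where "ctor n k = tor n (nat (k mod int n))"

lemma ctor_cong: "k mod int n = l mod int n \<Longrightarrow> ctor n k = ctor n l"
  by (simp add: ctor_def)

lemma ctor_Suc_cong: "k mod int n = l mod int n \<Longrightarrow> ctor n (k + 1) = ctor n (l + 1)"
  by (metis ctor_cong mod_add_cong)

lemma sgen_cong: "k mod int n = l mod int n \<Longrightarrow> sgen n k = sgen n l"
  by (simp add: sgen_def)

lemma tor_eq_ctor: "i \<le> n \<Longrightarrow> tor n i = ctor n (int i)"
  by (cases "i = n") (auto simp: ctor_def tor_def)

text \<open>The torus relations are indexed from 1 to \<open>n\<close>, so the residue 0 is
  represented by \<open>n\<close>.\<close>

lemma ctor_cases:
  assumes "n \<ge> 1"
  obtains j where "j \<in> {1..n}" "ctor n k = tor n j" "int j mod int n = k mod int n"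
proof (cases "k mod int n = 0")
  case True
  then show thesis
    using assms that[of n] by (simp add: ctor_def tor_def)
next
  case False
  have "0 \<le> k mod int n" "k mod int n < int n"
    using assms by simp_all
  with False have "nat (k mod int n) \<in> {1..n}" "int (nat (k mod int n)) mod int n = k mod int n"
    by auto
  then show thesis
    by (intro that[of "nat (k mod int n)"]) (simp_all add: ctor_def)
qed

lemma FF_sum_eq_ctor:
  assumes "n \<ge> 1"
  shows "FF_sum r n (nat (k mod int n)) = FF r (ctor n k) (ctor n (k + 1))"
proof -
  have "nat (k mod int n) + 1 \<le> n"
    using assms by (simp add: Suc_le_eq nat_less_iff)
  moreover have "ctor n (int (nat (k mod int n) + 1)) = ctor n (k + 1)"
    using assms ctor_Suc_cong[of "k mod int n" n k] by (simp add: add.commute)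
  moreover have "ctor n (k mod int n) = ctor n k"
    by (simp add: ctor_def)
  ultimately show ?thesis
    using assms by (simp add: FF_sum_eq tor_eq_ctor)
qed

text \<open>Both directions of the isomorphism are of this form, with \<open>F\<close> equal to
  \<open>FF_sum r n\<close> or to its negative.\<close>

definition refl_shift :: "(nat \<Rightarrow> falg) \<Rightarrow> gen \<Rightarrow> falg"
  where "refl_shift F g = (case g of Refl i \<Rightarrow> generator g + F i | _ \<Rightarrow> generator g)"

lemma subst_refl_shift [simp]:
  "subst (refl_shift F) (tor n j) = tor n j"
  "subst (refl_shift F) rho = rho"
  "subst (refl_shift F) rho_inv = rho_inv"
  "subst (refl_shift F) (sgen n k) = sgen n k + F (nat (k mod int n))"
  by (simp_all add: tor_def rho_def rho_inv_def sgen_def refl_shift_def)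

lemma subst_F_eval: "subst f (F_eval r c x) = F_eval r c (subst f x)"
  by (simp add: F_eval_def subst_simps)

text \<open>The correction term involves torus letters only, and the substitution fixes
  these.\<close>

lemma subst_FF_sum [simp]: "subst (refl_shift F) (FF_sum r n i) = FF_sum r n i"
  by (simp add: FF_sum_def subst_simps subst_F_eval case_prod_beta)

lemma subst_weighted_FF_sum [simp]: "subst (refl_shift F) (weighted_FF_sum r n i) = weighted_FF_sum r n i"
  by (simp add: weighted_FF_sum_def subst_simps subst_F_eval case_prod_beta)

lemma subst_e_elt [simp]: "subst (refl_shift F) (e_elt r n i) = e_elt r n i"
  by (simp add: e_elt_def subst_simps)

locale affine_letters = torus_coefficients r "gens n" for r n :: nat +
  assumes n_pos: "n \<ge> 1"
begin

lemma letters_S [simp]: "j \<le> n \<Longrightarrow> tor n j \<in> S" "sgen n k \<in> S" "rho \<in> S" "rho_inv \<in> S" "ctor n k \<in> S"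
proof -
  have tor: "tor n j \<in> S" if "j \<le> n" for j
    unfolding tor_def using n_pos that by (intro S_generator) (auto simp: gens_def)
  then show "j \<le> n \<Longrightarrow> tor n j \<in> S" .
  show "ctor n k \<in> S"
    using tor ctor_cases[OF n_pos, of k] by (metis atLeastAtMost_iff)
  show "sgen n k \<in> S"
    unfolding sgen_def using n_pos by (intro S_generator) (auto simp: gens_def nat_less_iff)
  show "rho \<in> S" "rho_inv \<in> S"
    unfolding rho_def rho_inv_def by (intro S_generator; simp add: gens_def)+
qed

lemma elements_S [simp]:
  assumes "i < n"
  shows "FF_sum r n i \<in> S" "weighted_FF_sum r n i \<in> S" "e_elt r n i \<in> S"
  using assms by (simp_all add: FF_sum_eq weighted_FF_sum_eq e_elt_eq FF_S weighted_FF_S e_poly_S)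

lemma H_relations_S: "H_relations r n \<subseteq> S \<times> S"
proof -
  have "tor n (Transposition.transpose i (i + 1) j) \<in> S" if "i < n" "j \<in> {1..n}" for i j
    using that by (auto simp: Transposition.transpose_def)
  then show ?thesis
    using const_base(2) unfolding H_relations_def by auto
qed

lemma C_relations_S: "C_relations r n \<subseteq> S \<times> S"
  using const_base(2) unfolding C_relations_def by auto

end

text \<open>The torus relations and those for \<open>rho\<close>, which are enough for calculating
  with torus elements and for conjugating by \<open>rho\<close> in either algebra.\<close>

definition common_relations :: "nat \<Rightarrow> nat \<Rightarrow> (falg \<times> falg) set"
  where "common_relations r n =
    {(tor n i ^ r, 1) | i. i \<in> {1..n}} \<union>
    {(tor n i * tor n j, tor n j * tor n i) | i j. i \<in> {1..n} \<and> j \<in> {1..n}} \<union>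
    {(rho * tor n j, tor n (j - 1) * rho) | j. j \<in> {1..n}} \<union>
    {(rho * sgen n (int i), sgen n (int i - 1) * rho) | i. i < n} \<union>
    {(rho * rho_inv, 1), (rho_inv * rho, 1)}"

section \<open>Torus elements with cyclic indices and conjugation by \<open>rho\<close>\<close>

locale affine_presentation = torus_presentation r "gens n" rel + affine_letters r n
  for r n :: nat and rel +
  assumes common: "common_relations r n \<subseteq> rel"
begin

notation eqv (infix \<open>\<approx>\<close> 50)

abbreviation "t \<equiv> ctor n"
abbreviation "P k \<equiv> FF r (t k) (t (k + 1))"

lemma common_eqv: "(p, q) \<in> common_relations r n \<Longrightarrow> p \<approx> q"
  using common eqv_rel by blast

lemma tor_relations:
  assumes "i \<in> {1..n}" "j \<in> {1..n}"
  shows "tor n i ^ r \<approx> 1" "tor n i * tor n j \<approx> tor n j * tor n i"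
    "rho * tor n i \<approx> tor n (i - 1) * rho"
  by (rule common_eqv, unfold common_relations_def, use assms in blast)+

lemma rho_rho_inv: "rho * rho_inv \<approx> 1" "rho_inv * rho \<approx> 1"
  by (rule common_eqv, simp add: common_relations_def)+

lemma t_root: "t k ^ r \<approx> 1"
proof -
  obtain j where j: "j \<in> {1..n}" "t k = tor n j"
    using ctor_cases[OF n_pos] by blast
  then show ?thesis
    using tor_relations(1) by simp
qed

lemma t_comm: "twine (t k) (t l) (t l)"
proof -
  obtain i where i: "i \<in> {1..n}" "t k = tor n i"
    using ctor_cases[OF n_pos, of k] by blast
  obtain j where j: "j \<in> {1..n}" "t l = tor n j"
    using ctor_cases[OF n_pos, of l] by blast
  show ?thesis
    using tor_relations(2)[OF i(1) j(1)] by (simp add: twine_def flip: i(2) j(2))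
qed

lemma rho_t: "twine rho (t k) (t (k - 1))"
proof -
  obtain j where j: "j \<in> {1..n}" "t k = tor n j" "int j mod int n = k mod int n"
    using ctor_cases[OF n_pos] by blast
  have "tor n (j - 1) = ctor n (int j - 1)"
    using j(1) tor_eq_ctor[of "j - 1" n] by (auto simp: of_nat_diff)
  also have "\<dots> = t (k - 1)"
    by (rule ctor_cong) (rule mod_diff_cong[OF j(3) refl])
  finally have eq: "tor n (j - 1) = t (k - 1)" .
  show ?thesis
    using tor_relations(3)[OF j(1) j(1)] unfolding twine_def eq j(2)[symmetric] by simp
qed

lemma rho_sgen: "twine rho (sgen n k) (sgen n (k - 1))"
proof -
  define i where "i = nat (k mod int n)"
  have i: "i < n" "int i = k mod int n"
    using n_pos by (simp_all add: i_def nat_less_iff)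
  then have eq: "sgen n (int i) = sgen n k" "sgen n (int i - 1) = sgen n (k - 1)"
    by (auto intro!: sgen_cong simp: mod_diff_left_eq)
  have "(rho * sgen n (int i), sgen n (int i - 1) * rho) \<in> common_relations r n"
    unfolding common_relations_def using i(1) by blast
  from common_eqv[OF this] show ?thesis
    unfolding twine_def eq by simp
qed

text \<open>Conjugation by the unit \<open>rho\<close> preserves congruences: multiply by
  \<open>rho\<close> on the left, let it pass to the right and cancel it with
  \<open>rho_inv\<close>.\<close>

lemma rho_transport:
  assumes "twine rho p p'" "twine rho q q'" "p \<approx> q"
  shows "p' \<approx> q'"
proof -
  note S = twine_S[OF assms(1)] twine_S[OF assms(2)]
  have "p' * rho \<approx> rho * p"
    by (rule eqv_sym[OF S(4)])
  also have "rho * p \<approx> rho * q"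
    using S assms(3) by (intro eqv_left)
  also have "rho * q \<approx> q' * rho"
    by (rule S(8))
  finally have "p' * rho \<approx> q' * rho" .
  then have cancel: "p' * rho * rho_inv \<approx> q' * rho * rho_inv"
    by (rule eqv_right[rotated]) simp
  have unit: "s * rho * rho_inv \<approx> s" if "s \<in> S" for s
    using eqv_left[OF that rho_rho_inv(1)] by (simp add: mult.assoc)
  show ?thesis
    using eqv_trans[OF eqv_sym[OF unit[OF S(3)]] eqv_trans[OF cancel unit[OF S(7)]]] .
qed

lemma twine_transport:
  assumes "twine rho T T'" "twine rho x x'" "twine rho y y'" "twine T x y"
  shows "twine T' x' y'"
  using rho_transport[OF twine_mult[OF assms(1,2)] twine_mult[OF assms(3,1)]] assms
  by (simp add: twine_def)

text \<open>With an integer index and residues compared modulo \<open>n\<close>, conjugation by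
  \<open>rho\<close> is the shift to \<open>k - 1\<close>, without a case for the
  wrap-around.\<close>

definition permutes_t :: "int \<Rightarrow> falg \<Rightarrow> bool"
  where "permutes_t k T \<longleftrightarrow> twine T (t k) (t (k + 1)) \<and> twine T (t (k + 1)) (t k) \<and>
    (\<forall>l. l mod int n \<noteq> k mod int n \<longrightarrow> l mod int n \<noteq> (k + 1) mod int n \<longrightarrow> twine T (t l) (t l))"

lemma permutes_t_shift:
  assumes "permutes_t k T" "twine rho T T'"
  shows "permutes_t (k - 1) T'"
proof -
  have fixed: "twine T' (t l) (t l)"
    if l: "l mod int n \<noteq> (k - 1) mod int n" "l mod int n \<noteq> (k - 1 + 1) mod int n" for l
  proof -
    have "(l + 1) mod int n \<noteq> k mod int n" "(l + 1) mod int n \<noteq> (k + 1) mod int n"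
      using l mod_diff_cong[of "l + 1" "int n" k 1 1] mod_diff_cong[of "l + 1" "int n" "k + 1" 1 1]
      by auto
    then have "twine T (t (l + 1)) (t (l + 1))"
      using assms(1) by (simp add: permutes_t_def)
    then show ?thesis
      using twine_transport[OF assms(2) rho_t rho_t, of "l + 1" "l + 1"] by simp
  qed
  show ?thesis
    using fixed assms(1) twine_transport[OF assms(2) rho_t rho_t, of k "k + 1"]
      twine_transport[OF assms(2) rho_t rho_t, of "k + 1" k]
    by (simp add: permutes_t_def)
qed

lemma permutes_t_cong:
  assumes "k mod int n = l mod int n" "permutes_t k T"
  shows "permutes_t l T"
proof -
  have "t k = t l" "t (k + 1) = t (l + 1)" "(k + 1) mod int n = (l + 1) mod int n"
    using assms(1) ctor_cong ctor_Suc_cong mod_add_cong by blast+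
  then show ?thesis
    using assms by (simp add: permutes_t_def)
qed

lemma P_S [simp]: "P k \<in> S"
  by (simp add: FF_S)

lemma P_cong: "k mod int n = l mod int n \<Longrightarrow> P k = P l"
  using ctor_cong[of k n l] ctor_Suc_cong[of k n l] by simp

lemma rho_P: "twine rho (P k) (P (k - 1))"
  using twine_FF[OF rho_t[of k] rho_t[of "k + 1"]] by simp

end

text \<open>Abstracts from the two sources of interchanging elements: \<open>sgen n\<close> in the
  first algebra, and \<open>sgen n\<close> minus the correction in the second. The interchange is
  demanded only for \<open>1 \<le> k < n\<close>, the range that the defining relations
  supply.\<close>

locale hecke_family = affine_presentation +
  fixes T :: "int \<Rightarrow> falg"
  assumes T_rho: "twine rho (T k) (T (k - 1))"
    and T_perm: "2 \<le> n \<Longrightarrow> 1 \<le> k \<Longrightarrow> k < int n \<Longrightarrow> permutes_t k (T k)"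
    and T_cong: "k mod int n = l mod int n \<Longrightarrow> T k = T l"
begin

lemma T_S [simp]: "T k \<in> S"
  using twine_S(2)[OF T_rho] .

lemma T_permutes:
  assumes "n \<ge> 2"
  shows "permutes_t k (T k)"
proof -
  have bounds: "0 \<le> k mod int n" "k mod int n < int n"
    using assms by simp_all
  have "permutes_t (k mod int n) (T (k mod int n))"
  proof (cases "k mod int n = 0")
    case True
    \<comment> \<open>The index 0 is written as a shift of 1, which lies in the range of
      \<open>T_perm\<close> because \<open>n \<ge> 2\<close>.\<close>
    have "permutes_t (1 - 1) (T (1 - 1))"
      using assms by (intro permutes_t_shift[OF T_perm T_rho]) auto
    with True show ?thesis by simp
  next
    case False
    then show ?thesis
      using assms bounds by (intro T_perm) auto
  qed
  then show ?thesis
    using T_cong[of "k mod int n" k] permutes_t_cong[of "k mod int n" k] by simp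
qed

lemma T_twine:
  assumes "n \<ge> 2"
  shows "twine (T k) (t k) (t (k + 1))" "twine (T k) (t (k + 1)) (t k)"
    "l mod int n \<noteq> k mod int n \<Longrightarrow> l mod int n \<noteq> (k + 1) mod int n \<Longrightarrow> twine (T k) (t l) (t l)"
  using T_permutes[OF assms] by (simp_all add: permutes_t_def)

lemma rho_shift: "twine rho (T k + P k) (T (k - 1) + P (k - 1))"
  by (rule twine_add[OF T_rho rho_P])

lemma quadratic_iff:
  "(T k + P k)\<^sup>2 \<approx> 1 + scalar zq * (T k + P k) \<longleftrightarrow>
    (T k)\<^sup>2 \<approx> 1 + scalar zq * e_poly r (t k) (t (k + 1)) * T k"
proof -
  have diff: "(T k + P k)\<^sup>2 - scalar zq * (T k + P k) \<approx>
      (T k)\<^sup>2 - scalar zq * e_poly r (t k) (t (k + 1)) * T k"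
  proof (cases "n \<ge> 2")
    case True
    then show ?thesis
      by (intro quadratic_shift t_comm t_root T_twine)
  next
    case False
    then have "n = 1"
      using n_pos by simp
    then have "t (k + 1) = t k"
      by (intro ctor_cong) simp
    then show ?thesis
      using quadratic_shift_diag[of "t k" "T k"] t_root by simp
  qed
  have "(T k + P k)\<^sup>2 - (1 + scalar zq * (T k + P k)) \<approx>
      (T k)\<^sup>2 - (1 + scalar zq * e_poly r (t k) (t (k + 1)) * T k)"
    using eqv_diff[OF diff eqv_refl[of 1]] by (simp add: algebra_simps)
  moreover have "e_poly r (t k) (t (k + 1)) \<in> S"
    by (simp add: e_poly_S)
  ultimately show ?thesis
    using const_base(2) by (intro eqv_iff_of_diff) auto
qed

text \<open>For \<open>n \<ge> 3\<close> the residues of \<open>k\<close>, \<open>k + 1\<close> and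
  \<open>k + 2\<close> are distinct, so each of the two reflections fixes the torus element that it
  does not move.\<close>

lemma braid_iff:
  assumes n: "n \<ge> 3"
    and quadratic: "\<And>k. (T k)\<^sup>2 \<approx> 1 + scalar zq * e_poly r (t k) (t (k + 1)) * T k"
  shows "(T k + P k) * (T (k + 1) + P (k + 1)) * (T k + P k) \<approx>
      (T (k + 1) + P (k + 1)) * (T k + P k) * (T (k + 1) + P (k + 1)) \<longleftrightarrow>
    T k * T (k + 1) * T k \<approx> T (k + 1) * T k * T (k + 1)"
proof -
  have neq: "(k + i) mod int n \<noteq> (k + j) mod int n" if "i \<noteq> j" "0 \<le> i" "i \<le> 2" "0 \<le> j" "j \<le> 2" for i j
  proof
    assume "(k + i) mod int n = (k + j) mod int n"
    then have "int n dvd (k + i) - (k + j)"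
      by (simp add: mod_eq_dvd_iff)
    then have "int n dvd i - j"
      by simp
    then have "int n \<le> \<bar>i - j\<bar>"
      using that by (intro dvd_imp_le_int[of "i - j" "int n", simplified]) auto
    then show False
      using that n by linarith
  qed
  have n2: "n \<ge> 2"
    using n by simp
  have eq: "k + 1 + 1 = k + 2"
    by simp
  note q = quadratic[of k] quadratic[of "k + 1", unfolded eq]
  have a: "twine (T k) (t (k + 2)) (t (k + 2))"
    using neq[of 2 0] neq[of 2 1] n2 by (intro T_twine) auto
  have b: "twine (T (k + 1)) (t k) (t k)"
    using neq[of 0 1] neq[of 0 2] n2 by (intro T_twine) (auto simp: eq)
  note a' = T_twine(1,2)[OF n2, of k] and b' = T_twine(1,2)[OF n2, of "k + 1", unfolded eq]
  have "FF r (t (k + 1)) (t (k + 2)) \<in> S"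
    by (simp add: FF_S)
  then show ?thesis
    unfolding eq by (intro eqv_iff_of_diff braid_shift t_root t_comm a a' b b' q) auto
qed

text \<open>For equal residues both equations are trivial. Otherwise the hypotheses make the
  residues of \<open>k\<close>, \<open>k + 1\<close> disjoint from those of \<open>l\<close>,
  \<open>l + 1\<close>, so each element of the family commutes with the other's correction.\<close>

lemma commute_iff:
  assumes "\<not> [k - l = 1] (mod int n)" "\<not> [k - l = - 1] (mod int n)"
  shows "(T k + P k) * (T l + P l) \<approx> (T l + P l) * (T k + P k) \<longleftrightarrow> T k * T l \<approx> T l * T k"
proof (cases "k mod int n = l mod int n")
  case True
  then show ?thesis
    using T_cong[OF True] P_cong[OF True] by (auto intro!: eqv_refl)
next
  case False
  have n2: "n \<ge> 2"
    using False n_pos by (cases "n = 1") auto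
  have ne: "(k + 1) mod int n \<noteq> l mod int n" "k mod int n \<noteq> (l + 1) mod int n"
    "(k + 1) mod int n \<noteq> (l + 1) mod int n"
  proof -
    show "k mod int n \<noteq> (l + 1) mod int n" "(k + 1) mod int n \<noteq> l mod int n"
      using assms by (auto simp: cong_def mod_eq_dvd_iff algebra_simps)
    show "(k + 1) mod int n \<noteq> (l + 1) mod int n"
      using False by (auto simp: mod_eq_dvd_iff)
  qed
  have "twine (T k) (P l) (P l)"
    using False ne False[symmetric] ne[symmetric] n2 by (intro twine_FF T_twine(3)) simp_all
  moreover have "twine (T l) (P k) (P k)"
    using False ne False[symmetric] ne[symmetric] n2 by (intro twine_FF T_twine(3)) simp_all
  moreover have "twine (P k) (P l) (P l)"
    by (intro twine_FF twine_commute[OF twine_FF] t_comm)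
  ultimately show ?thesis
    by (intro eqv_iff_of_diff commute_shift) auto
qed

lemma times_t:
  assumes n: "n \<ge> 2"
  shows "(T k + P k) * t k \<approx> t (k + 1) * (T k + P k) - weighted_FF r (t k) (t (k + 1))"
    and "(T k + P k) * t (k + 1) \<approx> t k * (T k + P k) + weighted_FF r (t k) (t (k + 1))"
    and "l mod int n \<noteq> k mod int n \<Longrightarrow> l mod int n \<noteq> (k + 1) mod int n \<Longrightarrow>
      (T k + P k) * t l \<approx> t l * (T k + P k)"
proof -
  have mem: "weighted_FF r (t k) (t (k + 1)) \<in> S"
    by (simp add: weighted_FF_S)
  note T = T_twine(1,2)[OF n, of k, THEN twine_S(4)]
  show "(T k + P k) * t k \<approx> t (k + 1) * (T k + P k) - weighted_FF r (t k) (t (k + 1))"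
    using eqv_iff_of_diff[OF shift_times_left[OF t_comm t_root t_root T_S]] T mem by simp
  show "(T k + P k) * t (k + 1) \<approx> t k * (T k + P k) + weighted_FF r (t k) (t (k + 1))"
    using eqv_iff_of_diff[OF shift_times_right[OF t_comm t_root t_root T_S]] T mem by simp
  assume "l mod int n \<noteq> k mod int n" "l mod int n \<noteq> (k + 1) mod int n"
  then have "twine (T k) (t l) (t l)"
    using T_twine(3)[OF n] by blast
  then have "T k * t l + P k * t l \<approx> t l * T k + t l * P k"
    using twine_commute[OF twine_FF[OF t_comm t_comm]] by (intro eqv_add) (simp_all add: twine_def)
  then show "(T k + P k) * t l \<approx> t l * (T k + P k)"
    by (simp add: distrib_left distrib_right)
qed

end

section \<open>The two presentations as instances, and the relations of each in the other\<close>

context affine_letters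
begin

sublocale H: affine_presentation r n "H_relations r n"
  by unfold_locales (rule H_relations_S, auto simp: H_relations_def common_relations_def)

sublocale C: affine_presentation r n "C_relations r n"
  by unfold_locales (rule C_relations_S, auto simp: C_relations_def common_relations_def)

text \<open>The defining relations are indexed by naturals below \<open>n\<close>; choosing this
  representative makes them available at every integer index.\<close>

lemma index_cases:
  obtains i where "i < n" "int i mod int n = k mod int n"
    "sgen n k = sgen n (int i)" "sgen n (k + 1) = sgen n (int i + 1)"
    "ctor n k = tor n i" "ctor n (k + 1) = tor n (i + 1)"
proof -
  define i where "i = nat (k mod int n)"
  have i: "i < n" "int i mod int n = k mod int n"
    using n_pos by (simp_all add: i_def nat_less_iff)
  have eq: "ctor n k = ctor n (int i)" "ctor n (k + 1) = ctor n (int i + 1)"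
    "sgen n k = sgen n (int i)"
    using i(2) by (auto intro!: ctor_cong ctor_Suc_cong sgen_cong)
  have "sgen n (k + 1) = sgen n (int i + 1)"
    by (intro sgen_cong mod_add_cong) (simp_all add: i)
  moreover have "tor n i = ctor n (int i)" "tor n (i + 1) = ctor n (int (i + 1))"
    using i(1) by (simp_all only: tor_eq_ctor less_imp_le Suc_leI Suc_eq_plus1[symmetric])
  ultimately show thesis
    using that[OF i] eq by (simp add: add.commute)
qed

lemma H_permutes:
  assumes "1 \<le> k" "k < int n"
  shows "H.permutes_t k (sgen n k)"
proof -
  define i where "i = nat k"
  have i: "1 \<le> i" "i < n" "k = int i"
    using assms by (auto simp: i_def)
  have tor: "ctor n k = tor n i" "ctor n (k + 1) = tor n (i + 1)"
    using i tor_eq_ctor[of i n] tor_eq_ctor[of "i + 1" n] by (simp_all add: add.commute)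
  have rel: "H.eqv (sgen n k * tor n j) (tor n (Transposition.transpose i (i + 1) j) * sgen n k)"
    if "j \<in> {1..n}" for j
  proof -
    have "(sgen n (int i) * tor n j, tor n (Transposition.transpose i (i + 1) j) * sgen n (int i))
        \<in> H_relations r n"
      unfolding H_relations_def using i(1,2) that by blast
    then show ?thesis
      unfolding i(3) by (rule H.eqv_rel)
  qed
  have fixed: "H.twine (sgen n k) (ctor n l) (ctor n l)"
    if l: "l mod int n \<noteq> k mod int n" "l mod int n \<noteq> (k + 1) mod int n" for l
  proof -
    obtain j where j: "j \<in> {1..n}" "ctor n l = tor n j" "int j mod int n = l mod int n"
      using ctor_cases[OF n_pos] by blast
    have "j \<noteq> i" "j \<noteq> i + 1"
      using l i j(3) by (auto simp: add.commute)
    then have "Transposition.transpose i (i + 1) j = j"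
      by (simp add: Transposition.transpose_def)
    then show ?thesis
      using rel[OF j(1)] by (simp add: H.twine_def flip: j(2))
  qed
  have "H.twine (sgen n k) (tor n i) (tor n (i + 1))" "H.twine (sgen n k) (tor n (i + 1)) (tor n i)"
    using rel[of i] rel[of "i + 1"] i by (simp_all add: H.twine_def)
  then show ?thesis
    using fixed unfolding H.permutes_t_def tor by blast
qed

sublocale HT: hecke_family r n "H_relations r n" "sgen n"
  by unfold_locales (rule H.rho_sgen H_permutes sgen_cong; assumption)+

lemma H_quadratic:
  "H.eqv ((sgen n k)\<^sup>2) (1 + scalar zq * e_poly r (ctor n k) (ctor n (k + 1)) * sgen n k)"
proof -
  obtain i where i: "i < n" "sgen n k = sgen n (int i)" "ctor n k = tor n i" "ctor n (k + 1) = tor n (i + 1)"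
    by (rule index_cases)
  have "((sgen n (int i))\<^sup>2, 1 + scalar zq * e_elt r n i * sgen n (int i)) \<in> H_relations r n"
    unfolding H_relations_def using i(1) by blast
  then show ?thesis
    unfolding i(2-4) e_elt_eq[symmetric] by (rule H.eqv_rel)
qed

lemma H_braid:
  assumes "n \<ge> 3"
  shows "H.eqv (sgen n k * sgen n (k + 1) * sgen n k) (sgen n (k + 1) * sgen n k * sgen n (k + 1))"
proof -
  obtain i where i: "i < n" "sgen n k = sgen n (int i)" "sgen n (k + 1) = sgen n (int i + 1)"
    by (rule index_cases)
  have "(sgen n (int i) * sgen n (int i + 1) * sgen n (int i),
      sgen n (int i + 1) * sgen n (int i) * sgen n (int i + 1)) \<in> H_relations r n"
    unfolding H_relations_def using i(1) assms by blast
  then show ?thesis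
    unfolding i(2-3) by (rule H.eqv_rel)
qed

definition "to_H = subst (refl_shift (FF_sum r n))"
definition "to_C = subst (refl_shift (\<lambda>i. - FF_sum r n i))"

lemma to_H_sgen: "to_H (sgen n k) = sgen n k + H.P k"
  by (simp add: to_H_def FF_sum_eq_ctor[OF n_pos])

lemma to_C_sgen: "to_C (sgen n k) = sgen n k - C.P k"
  by (simp add: to_C_def FF_sum_eq_ctor[OF n_pos])

lemma C_relations_in_H:
  assumes "(x, y) \<in> C_relations r n"
  shows "H.eqv (to_H x) (to_H y)"
proof -
  let ?h = "\<lambda>k. sgen n k + H.P k"
  have simps: "to_H (p * q) = to_H p * to_H q" "to_H (p + q) = to_H p + to_H q"
    "to_H (p - q) = to_H p - to_H q" "to_H (p ^ m) = to_H p ^ m" "to_H 1 = 1"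
    "to_H (scalar c) = scalar c" "to_H (tor n j) = tor n j" "to_H rho = rho" "to_H rho_inv = rho_inv"
    "to_H (weighted_FF_sum r n i) = weighted_FF_sum r n i" for p q m c i j
    by (simp_all add: to_H_def subst_simps)
  have rho_h: "H.eqv (rho * ?h k) (?h (k - 1) * rho)" for k
    by (rule H.twine_S(4)[OF HT.rho_shift])
  have comm: "H.eqv (?h (int i) * ?h (int j)) (?h (int j) * ?h (int i))"
    if "i < n" "j < n" "\<not> [int i - int j = 1] (mod int n)" "\<not> [int i - int j = - 1] (mod int n)" for i j
  proof -
    have "(sgen n (int i) * sgen n (int j), sgen n (int j) * sgen n (int i)) \<in> H_relations r n"
      unfolding H_relations_def using that by blast
    then show ?thesis
      using HT.commute_iff[OF that(3,4)] H.eqv_rel by blast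
  qed
  have braid: "H.eqv (?h k * ?h (k + 1) * ?h k) (?h (k + 1) * ?h k * ?h (k + 1))" if "n \<ge> 3" for k
    using HT.braid_iff[OF that H_quadratic] H_braid[OF that] by blast
  have quadratic: "H.eqv (?h k ^ 2) (1 + scalar zq * ?h k)" for k
    using HT.quadratic_iff H_quadratic by blast
  have W: "weighted_FF_sum r n i = weighted_FF r (ctor n (int i)) (ctor n (int i + 1))"
    "tor n (i + 1) = ctor n (int i + 1)" "tor n i = ctor n (int i)" if "i < n" for i
    using that tor_eq_ctor[of i n] tor_eq_ctor[of "i + 1" n]
    by (simp_all add: weighted_FF_sum_eq add.commute)
  have left: "H.eqv (?h (int i) * tor n i) (tor n (i + 1) * ?h (int i) - weighted_FF_sum r n i)"
    and right: "H.eqv (?h (int i) * tor n (i + 1)) (tor n i * ?h (int i) + weighted_FF_sum r n i)"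
    if "1 \<le> i" "i < n" for i
    unfolding W[OF that(2)] by (rule HT.times_t; use that in linarith)+
  have fixed: "H.eqv (?h (int i) * tor n l) (tor n l * ?h (int i))"
    if "1 \<le> i" "i < n" "l \<in> {1..n}" "l \<noteq> i" "l \<noteq> i + 1" for i l
  proof -
    have "int l mod int n \<noteq> int i mod int n" "int l mod int n \<noteq> (int i + 1) mod int n"
    proof -
      \<comment> \<open>Only the indices \<open>l = n\<close> and \<open>i + 1 = n\<close> differ
        from their residues, both having residue 0.\<close>
      have "int l mod int n = (if l = n then 0 else int l)"
        "(int i + 1) mod int n = (if i + 1 = n then 0 else int i + 1)" "int i mod int n = int i"
        using that by (auto simp: add.commute)
      then show "int l mod int n \<noteq> int i mod int n" "int l mod int n \<noteq> (int i + 1) mod int n"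
        using that by (auto split: if_splits)
    qed
    then show ?thesis
      using HT.times_t(3)[of "int l" "int i"] that by (simp add: tor_eq_ctor)
  qed
  show ?thesis
    using assms unfolding C_relations_def
  proof (elim UnE CollectE exE conjE, goal_cases)
    case (1 i)
    then show ?case by (simp only: prod.inject simps H.tor_relations)
  next
    case (2 i j)
    then show ?case by (simp only: prod.inject simps H.tor_relations)
  next
    case (3 j)
    then show ?case by (simp only: prod.inject simps H.tor_relations)
  next
    case (4 i)
    then show ?case by (simp only: prod.inject simps to_H_sgen rho_h)
  next
    case (5 i j)
    then show ?case by (simp only: prod.inject simps to_H_sgen comm not_False_eq_True)
  next
    case (6 i)
    then show ?case by (simp only: prod.inject simps to_H_sgen braid)
  next
    case (7 i)
    then show ?case by (simp only: prod.inject simps to_H_sgen quadratic)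
  next
    case (8 i)
    then show ?case by (simp only: prod.inject simps to_H_sgen left)
  next
    case (9 i)
    then show ?case by (simp only: prod.inject simps to_H_sgen right)
  next
    case (10 i l)
    then show ?case by (simp only: prod.inject simps to_H_sgen fixed not_False_eq_True)
  next
    case 11
    then show ?case by (elim insertE emptyE) (simp_all only: prod.inject simps H.rho_rho_inv)
  qed
qed

lemma C_sgen_times_tor:
  assumes "1 \<le> i" "i < n"
  shows "C.eqv (sgen n (int i) * tor n i) (tor n (i + 1) * sgen n (int i) - weighted_FF_sum r n i)"
    and "C.eqv (sgen n (int i) * tor n (i + 1)) (tor n i * sgen n (int i) + weighted_FF_sum r n i)"
    and "l \<in> {1..n} \<Longrightarrow> l \<noteq> i \<Longrightarrow> l \<noteq> i + 1 \<Longrightarrow> C.eqv (sgen n (int i) * tor n l) (tor n l * sgen n (int i))"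
proof -
  have rel: "(sgen n (int i) * tor n i, tor n (i + 1) * sgen n (int i) - weighted_FF_sum r n i)
      \<in> C_relations r n"
    "(sgen n (int i) * tor n (i + 1), tor n i * sgen n (int i) + weighted_FF_sum r n i)
      \<in> C_relations r n"
    unfolding C_relations_def using assms by blast+
  show "C.eqv (sgen n (int i) * tor n i) (tor n (i + 1) * sgen n (int i) - weighted_FF_sum r n i)"
    "C.eqv (sgen n (int i) * tor n (i + 1)) (tor n i * sgen n (int i) + weighted_FF_sum r n i)"
    using rel[THEN C.eqv_rel] .
  assume "l \<in> {1..n}" "l \<noteq> i" "l \<noteq> i + 1"
  then have "(sgen n (int i) * tor n l, tor n l * sgen n (int i)) \<in> C_relations r n"
    unfolding C_relations_def using assms by blast
  then show "C.eqv (sgen n (int i) * tor n l) (tor n l * sgen n (int i))"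
    by (rule C.eqv_rel)
qed

text \<open>Subtracting the correction cancels the weighted sums in the mixed relations for
  \<open>h\<close> and \<open>w\<close>, leaving a pure interchange.\<close>

lemma C_permutes:
  assumes "1 \<le> k" "k < int n"
  shows "C.permutes_t k (sgen n k - C.P k)"
proof -
  define i where "i = nat k"
  have i: "1 \<le> i" "i < n" "k = int i"
    using assms by (auto simp: i_def)
  let ?T = "sgen n k - C.P k"
  let ?x = "ctor n k" and ?y = "ctor n (k + 1)"
  have tor: "tor n i = ?x" "tor n (i + 1) = ?y"
    using i tor_eq_ctor[of i n] tor_eq_ctor[of "i + 1" n] by (simp_all add: add.commute)
  have W: "weighted_FF_sum r n i = weighted_FF r ?x ?y" "weighted_FF r ?x ?y \<in> S"
    unfolding weighted_FF_sum_eq tor by (simp_all add: weighted_FF_S)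
  note rel = C_sgen_times_tor(1,2)[OF i(1,2), folded i(3), unfolded W(1) tor]
  have T: "?T \<in> S"
    by simp
  \<comment> \<open>The comparison is applied to \<open>?T\<close>, whose shift
    \<open>?T + C.P k\<close> is again \<open>sgen n k\<close>.\<close>
  have "C.eqv (?T * ?x) (?y * ?T)"
    using C.eqv_iff_of_diff[OF C.shift_times_left[OF C.t_comm[of "k + 1" k] C.t_root C.t_root T]]
      rel(1) W(2) by simp
  moreover have "C.eqv (?T * ?y) (?x * ?T)"
    using C.eqv_iff_of_diff[OF C.shift_times_right[OF C.t_comm[of "k + 1" k] C.t_root C.t_root T]]
      rel(2) W(2) by simp
  moreover have "C.twine ?T (ctor n l) (ctor n l)"
    if l: "l mod int n \<noteq> k mod int n" "l mod int n \<noteq> (k + 1) mod int n" for l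
  proof -
    obtain j where j: "j \<in> {1..n}" "ctor n l = tor n j" "int j mod int n = l mod int n"
      using ctor_cases[OF n_pos] by blast
    have "j \<noteq> i" "j \<noteq> i + 1"
      using l i j(3) by (auto simp: add.commute)
    then have "C.twine (sgen n k) (ctor n l) (ctor n l)"
      using C_sgen_times_tor(3)[OF i(1,2) j(1)] by (simp add: C.twine_def i(3) flip: j(2))
    \<comment> \<open>Commutation is symmetric; with \<open>ctor n l\<close> in the role of the
      intertwiner, the difference \<open>?T\<close> can be treated term by term.\<close>
    then have "C.twine (ctor n l) ?T ?T"
      by (rule C.twine_diff[OF C.twine_commute C.twine_FF[OF C.t_comm C.t_comm]])
    then show ?thesis
      by (rule C.twine_commute)
  qed
  ultimately show ?thesis
    using T by (simp add: C.permutes_t_def C.twine_def)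
qed

text \<open>In this instance the shifted family is \<open>sgen n\<close> itself, so the shifted
  sides of the equivalences are defining relations and the other sides are what remains to be
  derived.\<close>

sublocale CT: hecke_family r n "C_relations r n" "\<lambda>k. sgen n k - C.P k"
proof unfold_locales
  show "C.twine rho (sgen n k - C.P k) (sgen n (k - 1) - C.P (k - 1))" for k
    by (rule C.twine_diff[OF C.rho_sgen C.rho_P])
  show "sgen n k - C.P k = sgen n l - C.P l" if "k mod int n = l mod int n" for k l
    using sgen_cong[OF that] C.P_cong[OF that] by simp
qed (rule C_permutes)

lemma C_quadratic:
  "C.eqv ((sgen n k - C.P k)\<^sup>2)
    (1 + scalar zq * e_poly r (ctor n k) (ctor n (k + 1)) * (sgen n k - C.P k))"
proof -
  obtain i where i: "i < n" "sgen n k = sgen n (int i)"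
    by (rule index_cases)
  have "((sgen n (int i))\<^sup>2, 1 + scalar zq * sgen n (int i)) \<in> C_relations r n"
    unfolding C_relations_def using i(1) by blast
  then have "C.eqv ((sgen n k)\<^sup>2) (1 + scalar zq * sgen n k)"
    unfolding i(2) by (rule C.eqv_rel)
  then show ?thesis
    using CT.quadratic_iff[of k] by (simp only: diff_add_cancel)
qed

lemma C_braid:
  assumes "n \<ge> 3"
  shows "C.eqv (sgen n k * sgen n (k + 1) * sgen n k) (sgen n (k + 1) * sgen n k * sgen n (k + 1))"
proof -
  obtain i where i: "i < n" "sgen n k = sgen n (int i)" "sgen n (k + 1) = sgen n (int i + 1)"
    by (rule index_cases)
  have "(sgen n (int i) * sgen n (int i + 1) * sgen n (int i),
      sgen n (int i + 1) * sgen n (int i) * sgen n (int i + 1)) \<in> C_relations r n"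
    unfolding C_relations_def using i(1) assms by blast
  then show ?thesis
    unfolding i(2-3) by (rule C.eqv_rel)
qed

lemma H_relations_in_C:
  assumes "(x, y) \<in> H_relations r n"
  shows "C.eqv (to_C x) (to_C y)"
proof -
  let ?T = "\<lambda>k. sgen n k - C.P k"
  have simps: "to_C (p * q) = to_C p * to_C q" "to_C (p + q) = to_C p + to_C q"
    "to_C (p ^ m) = to_C p ^ m" "to_C 1 = 1"
    "to_C (scalar c) = scalar c" "to_C (tor n j) = tor n j" "to_C rho = rho" "to_C rho_inv = rho_inv"
    "to_C (e_elt r n i) = e_elt r n i" for p q m c i j
    by (simp_all add: to_C_def subst_simps)
  have rho_T: "C.eqv (rho * ?T k) (?T (k - 1) * rho)" for k
    by (rule C.twine_S(4)[OF CT.T_rho])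
  have comm: "C.eqv (?T (int i) * ?T (int j)) (?T (int j) * ?T (int i))"
    if "i < n" "j < n" "\<not> [int i - int j = 1] (mod int n)" "\<not> [int i - int j = - 1] (mod int n)" for i j
  proof -
    have "(sgen n (int i) * sgen n (int j), sgen n (int j) * sgen n (int i)) \<in> C_relations r n"
      unfolding C_relations_def using that by blast
    then show ?thesis
      using CT.commute_iff[OF that(3,4)] C.eqv_rel by (simp only: diff_add_cancel)
  qed
  have braid: "C.eqv (?T k * ?T (k + 1) * ?T k) (?T (k + 1) * ?T k * ?T (k + 1))" if "n \<ge> 3" for k
    using CT.braid_iff[OF that C_quadratic] C_braid[OF that, of k] by (simp only: diff_add_cancel)
  have quadratic: "C.eqv (?T (int i) ^ 2) (1 + scalar zq * e_elt r n i * ?T (int i))" if "i < n" for i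
    using C_quadratic[of "int i"] that tor_eq_ctor[of i n] tor_eq_ctor[of "i + 1" n]
    by (simp add: e_elt_eq add.commute)
  have tor: "C.eqv (?T (int i) * tor n j) (tor n (Transposition.transpose i (i + 1) j) * ?T (int i))"
    if "1 \<le> i" "i < n" "j \<in> {1..n}" for i j
  proof -
    have perm: "C.permutes_t (int i) (?T (int i))"
      using that by (intro C_permutes) auto
    have eq: "tor n i = ctor n (int i)" "tor n (i + 1) = ctor n (int i + 1)" "tor n j = ctor n (int j)"
      using that tor_eq_ctor[of i n] tor_eq_ctor[of "i + 1" n] tor_eq_ctor[of j n]
      by (simp_all add: add.commute)
    consider "j = i" | "j = i + 1" | "j \<noteq> i" "j \<noteq> i + 1"
      by blast
    then show ?thesis
    proof cases
      case 3
      have "int j mod int n = (if j = n then 0 else int j)"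
        "(int i + 1) mod int n = (if i + 1 = n then 0 else int i + 1)" "int i mod int n = int i"
        using that by (auto simp: add.commute)
      then have "int j mod int n \<noteq> int i mod int n" "int j mod int n \<noteq> (int i + 1) mod int n"
        using that 3 by (auto split: if_splits)
      then have "C.twine (?T (int i)) (tor n j) (tor n j)"
        using perm unfolding C.permutes_t_def eq by blast
      with 3 show ?thesis
        by (simp add: C.twine_def Transposition.transpose_def)
    qed (use perm in \<open>simp_all add: C.permutes_t_def C.twine_def flip: eq\<close>)
  qed
  show ?thesis
    using assms unfolding H_relations_def
  proof (elim UnE CollectE exE conjE, goal_cases)
    case (1 i)
    then show ?case by (simp only: prod.inject simps C.tor_relations)
  next
    case (2 i j)
    then show ?case by (simp only: prod.inject simps C.tor_relations)
  next
    case (3 i j)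
    then show ?case by (simp only: prod.inject simps to_C_sgen tor)
  next
    case (4 j)
    then show ?case by (simp only: prod.inject simps C.tor_relations)
  next
    case (5 i)
    then show ?case by (simp only: prod.inject simps to_C_sgen rho_T)
  next
    case (6 i j)
    then show ?case by (simp only: prod.inject simps to_C_sgen comm not_False_eq_True)
  next
    case (7 i)
    then show ?case by (simp only: prod.inject simps to_C_sgen braid)
  next
    case (8 i)
    then show ?case by (simp only: prod.inject simps to_C_sgen quadratic)
  next
    case 9
    then show ?case by (elim insertE emptyE) (simp_all only: prod.inject simps C.rho_rho_inv)
  qed
qed

section \<open>Mutually inverse substitutions and the isomorphism\<close>

lemma refl_shift_S:
  assumes "\<And>i. i < n \<Longrightarrow> F i \<in> S" "g \<in> gens n"
  shows "refl_shift F g \<in> S"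
proof (cases g)
  case (Refl i)
  then have "i < n"
    using assms(2) by (auto simp: gens_def)
  with Refl show ?thesis
    using assms S_generator[OF assms(2)] by (simp add: refl_shift_def)
qed (use S_generator[OF assms(2)] in \<open>simp_all add: refl_shift_def\<close>)

text \<open>The two shifts cancel already in the free algebra, since the added terms are fixed up to
  sign.\<close>

lemma subst_refl_shift_inverse:
  assumes "\<And>i. subst (refl_shift F) (F' i) = - F i"
  shows "subst (refl_shift F) (refl_shift F' g) = generator g"
  using assms by (simp add: refl_shift_def subst_add split: gen.split)

end

theorem theorem3p2:
  fixes r n :: nat
  assumes "r \<ge> 1" and "n \<ge> 1"
  shows "\<exists>\<phi> \<psi>.
    \<phi> \<in> algebra_iso (base_ring r) (H_aff r n) (C_aff r n) \<and>
    (\<forall>j\<in>{1..n}. \<phi> (H_class r n (tor n j)) = C_class r n (tor n j)) \<and>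
    \<phi> (H_class r n rho) = C_class r n rho \<and>
    \<phi> (H_class r n rho_inv) = C_class r n rho_inv \<and>
    (\<forall>i<n. \<phi> (H_class r n (sgen n (int i))) = C_class r n (sgen n (int i) - FF_sum r n i)) \<and>
    \<psi> \<in> algebra_iso (base_ring r) (C_aff r n) (H_aff r n) \<and>
    (\<forall>x\<in>carrier (H_aff r n). \<psi> (\<phi> x) = x) \<and>
    (\<forall>y\<in>carrier (C_aff r n). \<phi> (\<psi> y) = y) \<and>
    (\<forall>j\<in>{1..n}. \<psi> (C_class r n (tor n j)) = H_class r n (tor n j)) \<and>
    \<psi> (C_class r n rho) = H_class r n rho \<and>
    \<psi> (C_class r n rho_inv) = H_class r n rho_inv \<and>
    (\<forall>i<n. \<psi> (C_class r n (sgen n (int i))) = H_class r n (sgen n (int i) + FF_sum r n i))"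
proof -
  interpret coefficient_ring "base_ring r" "gens n"
    by (rule coefficient_ring_base)
  interpret affine_letters r n
    by unfold_locales (use assms in auto)
  let ?f = "refl_shift (\<lambda>i. - FF_sum r n i)" and ?g = "refl_shift (FF_sum r n)"
  have f: "?f a \<in> S" and g: "?g a \<in> S" if "a \<in> gens n" for a
    using that by (auto intro!: refl_shift_S)
  have gf: "H.eqv (subst ?g (?f a)) (generator a)" and fg: "C.eqv (subst ?f (?g a)) (generator a)"
    if "a \<in> gens n" for a
    using that subst_refl_shift_inverse[of "FF_sum r n" "\<lambda>i. - FF_sum r n i" a]
      subst_refl_shift_inverse[of "\<lambda>i. - FF_sum r n i" "FF_sum r n" a]
    by (simp_all add: subst_uminus)
  obtain \<phi> \<psi> where maps:
    "\<phi> \<in> algebra_iso (base_ring r) (H_aff r n) (C_aff r n)"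
    "\<psi> \<in> algebra_iso (base_ring r) (C_aff r n) (H_aff r n)"
    "\<forall>x\<in>carrier (H_aff r n). \<psi> (\<phi> x) = x"
    "\<forall>y\<in>carrier (C_aff r n). \<phi> (\<psi> y) = y"
    "\<forall>p\<in>S. \<phi> (H_class r n p) = C_class r n (subst ?f p)"
    "\<forall>p\<in>S. \<psi> (C_class r n p) = H_class r n (subst ?g p)"
    unfolding H_aff_def C_aff_def H_class_def C_class_def
    by (rule presented_algebra_iso[OF H.presentation_axioms C.presentation_axioms f g
        H_relations_in_C[unfolded to_C_def] C_relations_in_H[unfolded to_H_def] gf fg];
        (assumption | (rule that; assumption)))
  show ?thesis
    using maps by (intro exI[of _ \<phi>] exI[of _ \<psi>]) simp
qed

end
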